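(* Let $f_1,\dots,f_n:\mathbb{R}^d\to\mathbb{R}$ be differentiable (possibly nonconvex) with $\|\nabla f_i(x)-\nabla f_i(y)\|\le L\|x-y\|$ for all $x,y\in\mathbb{R}^d$ and $i\in[n]$; let $f=\frac1n\sum_{i=1}^nf_i$ and $F=f+g$, with $\operatorname{dom}(F)\ne\emptyset$ and $F^\star:=\inf_{x\in\mathbb{R}^d}F(x)>-\infty$; and let the client sampling scheme $\hat{\mathcal S}$ be proper, i.e. $p_i=\mathbb{P}(i\in\hat{\mathcal S})>0$ for all $i\in[n]$, with $\hat p=\min\{p_i:i\in[n]\}>0$. Let $\gamma_1,\gamma_2,\gamma_3,\gamma_4>0$ be constants. Let $(x_i^k,z_i^k,\hat x_i^k,\bar x^k)_{k\ge0}$ be generated by FedADMM using a penalty parameter $\eta$ that satisfies $$\eta>\frac{4L(1+2\gamma_4)}{\sqrt{9-16\gamma_4(1+4\gamma_4)}-1}.$$ Then, when $g\equiv0$, the following holds: $$\frac1{K+1}\sum_{k=0}^K\mathbb{E}\big[\|\nabla f(\bar x^k)\|^2\big]\le\frac{C_1[F(x^0)-F^\star]}{K+1}+\frac1{n(K+1)}\sum_{k=0}^K\sum_{i=1}^n\big(C_2\epsilon_{i,k}^2+C_3\epsilon_{i,k+1}^2\big),$$ where $\hat\eta=1/\eta$ and $$\beta=\frac{\hat p\,\big[2-(L\hat\eta+1)-2L^2\hat\eta^2-4\gamma_4(1+L^2\hat\eta^2)\big]}{2\hat\eta(1+\gamma_1)(1+L^2\hat\eta^2)}>0,$$ $$\rho_2=\frac{2(1+\hat\eta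 L)^2}{\gamma_4\hat\eta}+\frac{1+\hat\eta^2L^2}{\hat\eta}+\frac{2-(L\hat\eta+1)-2L^2\hat\eta^2-4\gamma_4(1+L^2\hat\eta^2)}{2\hat\eta(1+L^2\hat\eta^2)\gamma_1},\qquad \rho_1=\rho_2+\frac{1+\hat\eta^2L^2}{\hat\eta},$$ $$C_1=\frac{2(1+\hat\eta L)^2(1+\gamma_2)}{\hat\eta^2\beta},\qquad C_2=\rho_1C_1,\qquad C_3=\rho_2C_1+\frac{(1+\hat\eta L)^2(1+\gamma_2)}{\hat\eta^2\gamma_2}.$$
   Context: Notation: $[n]=\{1,\dots,n\}$; $\|\cdot\|$ is the Euclidean norm; $g$ is proper, closed and convex; $\operatorname{prox}_{g/\eta}(x)=\arg\min_y\{g(y)+\frac\eta2\|x-y\|^2\}$. Expectation is with respect to all random variables in the algorithm. The underlying problem is $\min_{x\in\mathbb{R}^d}F(x)$. FedADMM with penalty parameter $\eta>0$, initial point $x^0$ and tolerances $\epsilon_{i,k}\ge0$. Initialize $\bar x^0=\tilde x^0=x^0$ on the server and $z_i^0=0$, $x_i^0=\hat x_i^0=x^0$ on all clients $i\in[n]$. For $k=0,\dots,K$: randomly sample a set of active clients $\mathcal S_k\subseteq[n]$ with size $S$ by the scheme $\hat{\mathcal S}$. Each $i\in\mathcal S_k$ receives $\bar x^k$ and computes $x_i^{k+1}$ as an approximate minimizer (within Euclidean distance $\epsilon_{i,k+1}$ of the exact one) of $$x_i\mapsto f_i(x_i)+g(\bar x^k)+\langle z_i^k,x_i-\bar x^k\rangle+\tfrac\eta2\|x_i-\bar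 x^k\|^2,$$ then $z_i^{k+1}=z_i^k+\eta(x_i^{k+1}-\bar x^k)$ and $\hat x_i^{k+1}=x_i^{k+1}+\frac1\eta z_i^{k+1}$. Clients $i\notin\mathcal S_k$ leave their variables unchanged. The server sets $\tilde x^{k+1}=\tilde x^k+\frac1n\sum_{i\in\mathcal S_k}(\hat x_i^{k+1}-\hat x_i^k)$ and $\bar x^{k+1}=\operatorname{prox}_{g/\eta}(\tilde x^{k+1})$; when $g\equiv0$ this is $\bar x^{k+1}=\tilde x^{k+1}=\frac1n\sum_{i=1}^n\hat x_i^{k+1}$.
   Formalization: Added: x^0 is within ε_{i,0} of the exact minimizer of f_i(x)+(η/2)‖x−x^0‖² for each i (with arbitrary ε_{i,0} the bound is false), and √(9−16γ_4(1+4γ_4))>1, i.e. γ_4<1/4 (otherwise β>0 fails). *)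

theory Defs
  imports "HOL-Probability.Probability"
begin

section \<open>Gradients, proper closed convex functions, proximal operators\<close>

definition gradient :: "('a::real_inner \<Rightarrow> real) \<Rightarrow> 'a \<Rightarrow> 'a" where
  "gradient f x = (THE D. GDERIV f x :> D)"

text \<open>Closedness and convexity of an extended real-valued function are those of its epigraph in
  the product space; the library's \<open>epigraph\<close> only covers real-valued functions.\<close>

definition ereal_epigraph :: "('a \<Rightarrow> ereal) \<Rightarrow> ('a \<times> real) set" where
  "ereal_epigraph g = {(x, r). g x \<le> ereal r}"

definition proper_closed_convex :: "('a::euclidean_space \<Rightarrow> ereal) \<Rightarrow> bool" where
  "proper_closed_convex g \<longleftrightarrow>
     (\<forall>x. g x \<noteq> -\<infinity>) \<and> (\<exists>x. g x \<noteq> \<infinity>) \<and>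
     closed (ereal_epigraph g) \<and> convex (ereal_epigraph g)"

text \<open>\<open>prox g \<eta>\<close> is the proximal operator of \<open>g/\<eta>\<close>: the parameter multiplies the quadratic term.\<close>

definition prox :: "('a::euclidean_space \<Rightarrow> ereal) \<Rightarrow> real \<Rightarrow> 'a \<Rightarrow> 'a" where
  "prox g \<eta> x = arg_min (\<lambda>y. g y + ereal (\<eta> / 2 * (norm (x - y))\<^sup>2)) (\<lambda>_. True)"

definition approx_minimizer :: "('a::metric_space \<Rightarrow> ereal) \<Rightarrow> real \<Rightarrow> 'a \<Rightarrow> bool" where
  "approx_minimizer \<phi> \<delta> y \<longleftrightarrow> (\<exists>u. is_arg_min \<phi> (\<lambda>_. True) u \<and> dist y u \<le> \<delta>)"

section \<open>The composite problem\<close>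

text \<open>The clients are \<open>{1..n}\<close>; the values of \<open>f i\<close> for other \<open>i\<close> are irrelevant.\<close>

definition avg_fun :: "nat \<Rightarrow> (nat \<Rightarrow> 'a \<Rightarrow> real) \<Rightarrow> 'a \<Rightarrow> real" where
  "avg_fun n f x = 1 / real n * (\<Sum>i=1..n. f i x)"

definition composite :: "nat \<Rightarrow> (nat \<Rightarrow> 'a \<Rightarrow> real) \<Rightarrow> ('a \<Rightarrow> ereal) \<Rightarrow> 'a \<Rightarrow> ereal" where
  "composite n f g x = ereal (avg_fun n f x) + g x"

section \<open>FedADMM\<close>

text \<open>Objective of a client with loss \<open>fi\<close> and dual variable \<open>z\<close> that has received \<open>xb\<close>.\<close>

definition client_objective ::
  "('a::euclidean_space \<Rightarrow> real) \<Rightarrow> ('a \<Rightarrow> ereal) \<Rightarrow> real \<Rightarrow> 'a \<Rightarrow> 'a \<Rightarrow> 'a \<Rightarrow> ereal" where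
  "client_objective fi g \<eta> xb z y =
     ereal (fi y) + g xb + ereal (z \<bullet> (y - xb)) + ereal (\<eta> / 2 * (norm (y - xb))\<^sup>2)"

text \<open>One trajectory of the iterations \<open>0, \<dots>, K\<close>, for given sets \<open>A k\<close> of active clients.
  Client variables are indexed by the client first and the iteration second;
  \<open>xh\<close>, \<open>xt\<close>, \<open>xb\<close> are the variables written with a hat, a tilde and a bar.\<close>

definition fedadmm_run ::
  "nat \<Rightarrow> nat \<Rightarrow> nat \<Rightarrow> (nat \<Rightarrow> 'a::euclidean_space \<Rightarrow> real) \<Rightarrow> ('a \<Rightarrow> ereal) \<Rightarrow> real \<Rightarrow> 'a \<Rightarrow>
   (nat \<Rightarrow> nat \<Rightarrow> real) \<Rightarrow> (nat \<Rightarrow> nat set) \<Rightarrow>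
   (nat \<Rightarrow> nat \<Rightarrow> 'a) \<Rightarrow> (nat \<Rightarrow> nat \<Rightarrow> 'a) \<Rightarrow> (nat \<Rightarrow> nat \<Rightarrow> 'a) \<Rightarrow> (nat \<Rightarrow> 'a) \<Rightarrow> (nat \<Rightarrow> 'a) \<Rightarrow> bool"
where
  "fedadmm_run n m K f g \<eta> x0 \<epsilon> A x z xh xt xb \<longleftrightarrow>
     xb 0 = x0 \<and> xt 0 = x0 \<and>
     (\<forall>i\<in>{1..n}. z i 0 = 0 \<and> x i 0 = x0 \<and> xh i 0 = x0) \<and>
     (\<forall>k\<le>K.
        A k \<subseteq> {1..n} \<and> card (A k) = m \<and>
        (\<forall>i\<in>A k.
           approx_minimizer (client_objective (f i) g \<eta> (xb k) (z i k)) (\<epsilon> i (Suc k)) (x i (Suc k)) \<and>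
           z i (Suc k) = z i k + \<eta> *\<^sub>R (x i (Suc k) - xb k) \<and>
           xh i (Suc k) = x i (Suc k) + (1 / \<eta>) *\<^sub>R z i (Suc k)) \<and>
        (\<forall>i\<in>{1..n} - A k.
           x i (Suc k) = x i k \<and> z i (Suc k) = z i k \<and> xh i (Suc k) = xh i k) \<and>
        xt (Suc k) = xt k + (1 / real n) *\<^sub>R (\<Sum>i\<in>A k. xh i (Suc k) - xh i k) \<and>
        xb (Suc k) = prox g \<eta> (xt (Suc k)))"

text \<open>The random algorithm. The \<open>\<sigma>\<close>-algebra \<open>H k\<close> is the information available at the start of
  iteration \<open>k\<close>: all current variables are known, and the active set \<open>A k\<close> is drawn from the
  sampling scheme \<open>P\<close> independently of \<open>H k\<close>. Nothing is assumed on how the inexact client solutions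
  \<open>x i (Suc k)\<close> are chosen within their tolerance, so they may depend on \<open>A k\<close>, on the past and on
  further randomness.\<close>

definition fedadmm ::
  "'w measure \<Rightarrow> (nat \<Rightarrow> 'w measure) \<Rightarrow> nat set pmf \<Rightarrow>
   nat \<Rightarrow> nat \<Rightarrow> nat \<Rightarrow> (nat \<Rightarrow> 'a::euclidean_space \<Rightarrow> real) \<Rightarrow> ('a \<Rightarrow> ereal) \<Rightarrow> real \<Rightarrow> 'a \<Rightarrow>
   (nat \<Rightarrow> nat \<Rightarrow> real) \<Rightarrow> (nat \<Rightarrow> 'w \<Rightarrow> nat set) \<Rightarrow>
   (nat \<Rightarrow> nat \<Rightarrow> 'w \<Rightarrow> 'a) \<Rightarrow> (nat \<Rightarrow> nat \<Rightarrow> 'w \<Rightarrow> 'a) \<Rightarrow> (nat \<Rightarrow> nat \<Rightarrow> 'w \<Rightarrow> 'a) \<Rightarrow>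
   (nat \<Rightarrow> 'w \<Rightarrow> 'a) \<Rightarrow> (nat \<Rightarrow> 'w \<Rightarrow> 'a) \<Rightarrow> bool"
where
  "fedadmm M H P n m K f g \<eta> x0 \<epsilon> A x z xh xt xb \<longleftrightarrow>
     prob_space M \<and> filtration (space M) H \<and> (\<forall>k. subalgebra M (H k)) \<and>
     (\<forall>k\<le>Suc K.
        (\<forall>i\<in>{1..n}. x i k \<in> borel_measurable (H k) \<and> z i k \<in> borel_measurable (H k) \<and>
                    xh i k \<in> borel_measurable (H k)) \<and>
        xt k \<in> borel_measurable (H k) \<and> xb k \<in> borel_measurable (H k)) \<and>
     (\<forall>k\<le>K.
        A k \<in> measurable (H (Suc k)) (count_space UNIV) \<and>
        distr M (count_space UNIV) (A k) = measure_pmf P \<and>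
        prob_space.indep_set M (sets (H k)) (sets (vimage_algebra (space M) (A k) (count_space UNIV)))) \<and>
     (\<forall>\<omega>\<in>space M.
        fedadmm_run n m K f g \<eta> x0 \<epsilon> (\<lambda>k. A k \<omega>) (\<lambda>i k. x i k \<omega>) (\<lambda>i k. z i k \<omega>)
          (\<lambda>i k. xh i k \<omega>) (\<lambda>k. xt k \<omega>) (\<lambda>k. xb k \<omega>))"

definition inclusion_prob :: "nat set pmf \<Rightarrow> nat \<Rightarrow> real" where
  "inclusion_prob P i = measure_pmf.prob P {B. i \<in> B}"

definition min_inclusion_prob :: "nat \<Rightarrow> nat set pmf \<Rightarrow> real" where
  "min_inclusion_prob n P = Min (inclusion_prob P ` {1..n})"

end

theory Submission
  imports Defs
begin

text \<open>
  Without regularizer the server average \<open>xb\<close> exactly minimizes the sum of the augmented Lagrangians,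
  and an update of client \<open>i\<close> decreases its augmented Lagrangian by at least \<open>\<kappa> \<parallel>xb - x\<^sub>i\<parallel>\<^sup>2\<close>, up to
  multiples of the squares of its old and new inexactness. Only active clients contribute errors, but
  an idle client keeps its old inexactness \<open>\<tau>\<^sub>i\<close>, and summing \<open>\<tau>\<^sub>i\<^sup>2\<close> over the idle period would cost a
  factor \<open>1 / p\<^sub>i\<close>. Adding a multiple of \<open>\<tau>\<^sub>i\<^sup>2\<close> to the potential cures this: it is reset exactly when
  the client is active, so one iteration gains in expectation
  \<open>p\<^sub>i (\<kappa> \<parallel>xb - x\<^sub>i\<parallel>\<^sup>2 + \<kappa> / \<gamma>1 \<tau>\<^sub>i\<^sup>2)\<close>, which dominates the squared gradient at \<open>xb\<close>.
\<close>

text \<open>An inexact client solution may depend on the active set, so averaging over the new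
  iterates is avoided. In the one-step inequality, which holds along every trajectory, they survive
  only through deterministic tolerances, and the activity indicator multiplies a quantity already
  known before the set is drawn. Independence turns this indicator into an inclusion probability
  without conditional expectations.

  No moments of the iterates are assumed. The potential lies between two constants on every
  trajectory, and it dominates the gain, hence the squared gradient; this supplies integrability.

  Inexactness is the distance to the solution of a proximal equation in \<open>x - \<zeta>\<close>
  that does not mention the server point. It therefore remains valid while a client is idle and the
  server moves.

  Division by \<open>\<eta>\<close> leaves \<open>l = L / \<eta>\<close> and
  \<open>\<gamma>4\<close> as the only constants of the one-client estimates, and the condition on
  \<open>\<eta>\<close> becomes positivity of a quadratic in \<open>l\<close>.\<close>

section \<open>Gradients of real-valued functions\<close>

lemma gradient_eqI:
  assumes "GDERIV f x :> D"
  shows "gradient f x = D"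
  unfolding gradient_def
proof (rule the_equality, fact assms)
  fix D' assume "GDERIV f x :> D'"
  with assms have "(\<lambda>h. inner h D') = (\<lambda>h. inner h D)"
    unfolding gderiv_def using has_derivative_unique by blast
  then show "D' = D"
    by (metis inner_commute vector_eq_ldot)
qed

text \<open>Riesz representation: the vector whose coordinates are the values of the derivative on
  \<open>Basis\<close> represents it. \<open>gradient\<close> is a definite description, so a
  witness is needed before it says anything.\<close>

lemma GDERIV_gradient:
  fixes f :: "'a::euclidean_space \<Rightarrow> real"
  assumes "f differentiable (at x)"
  shows "GDERIV f x :> gradient f x"
proof -
  obtain f' where f': "(f has_derivative f') (at x)"
    using assms by (auto simp: differentiable_def)
  define D where "D = (\<Sum>b\<in>Basis. f' b *\<^sub>R b)"
  have "f' v = inner v D" for v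
  proof -
    have "f' v = f' (\<Sum>b\<in>Basis. (v \<bullet> b) *\<^sub>R b)"
      by (simp add: euclidean_representation)
    also have "\<dots> = (\<Sum>b\<in>Basis. (v \<bullet> b) * f' b)"
      using has_derivative_linear[OF f'] by (simp add: linear_sum linear_scale)
    finally show ?thesis
      by (simp add: D_def inner_sum_right mult.commute)
  qed
  then have "GDERIV f x :> D"
    using f' unfolding gderiv_def by (metis (no_types, lifting) ext)
  then show ?thesis
    using gradient_eqI by metis
qed

lemma GDERIV_sum:
  assumes "\<And>i. i \<in> I \<Longrightarrow> GDERIV (f i) x :> D i"
  shows "GDERIV (\<lambda>y. \<Sum>i\<in>I. f i y) x :> (\<Sum>i\<in>I. D i)"
  using assms unfolding gderiv_def inner_sum_right by (intro has_derivative_sum)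

lemma GDERIV_cmult:
  assumes "GDERIV f x :> D"
  shows "GDERIV (\<lambda>y. c * f y) x :> c *\<^sub>R D"
  using assms unfolding gderiv_def inner_scaleR_right by (intro has_derivative_mult_right)

section \<open>Augmented Lagrangian of one client\<close>

locale smooth_fun =
  fixes \<phi> :: "'a::real_inner \<Rightarrow> real" and G :: "'a \<Rightarrow> 'a" and l :: real
  assumes GDERIV: "GDERIV \<phi> x :> G x"
    and lipschitz: "norm (G x - G y) \<le> l * norm (x - y)"
begin

lemma continuous_grad: "continuous_on UNIV G"
proof -
  \<comment> \<open>\<open>lipschitz_on\<close> demands a nonnegative constant, while the locale
    leaves the sign of \<open>l\<close> open.\<close>
  have "\<bar>l\<bar>-lipschitz_on UNIV G"
    by (rule lipschitz_onI)
      (use lipschitz mult_right_mono[OF abs_ge_self[of l] norm_ge_zero] in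
        \<open>auto simp: dist_norm intro: order_trans\<close>)
  then show ?thesis
    by (rule lipschitz_on_continuous_on)
qed

lemma continuous: "continuous_on UNIV \<phi>"
  using GDERIV unfolding gderiv_def
  by (meson continuous_at_imp_continuous_on has_derivative_continuous)

text \<open>The descent lemma in both directions. The sign \<open>s\<close> treats the two at once:
  along the segment the signed linearization error minus its quadratic bound is nonincreasing, by
  Cauchy-Schwarz and the Lipschitz bound.\<close>

lemma quadratic_bound:
  "\<bar>\<phi> b - \<phi> a - G a \<bullet> (b - a)\<bar> \<le> l / 2 * (norm (b - a))\<^sup>2"
proof -
  have upper: "s * (\<phi> b - \<phi> a - G a \<bullet> (b - a)) \<le> l / 2 * (norm (b - a))\<^sup>2"
    if s: "\<bar>s\<bar> = 1" for s
  proof -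
    define \<psi> where "\<psi> t = s * (\<phi> (a + t *\<^sub>R (b - a)) - t * (G a \<bullet> (b - a)))
      - l / 2 * t\<^sup>2 * (norm (b - a))\<^sup>2" for t
    have *: "\<exists>y. DERIV \<psi> t :> y \<and> y \<le> 0" if t: "0 \<le> t" for t
    proof -
      have "((\<lambda>t. \<phi> (a + t *\<^sub>R (b - a))) has_derivative
          (\<lambda>r. (r *\<^sub>R (b - a)) \<bullet> G (a + t *\<^sub>R (b - a)))) (at t)"
        by (rule has_derivative_compose[OF _ GDERIV[unfolded gderiv_def]])
          (auto intro!: derivative_eq_intros)
      then have d: "DERIV (\<lambda>t. \<phi> (a + t *\<^sub>R (b - a))) t :> (b - a) \<bullet> G (a + t *\<^sub>R (b - a))"
        by (simp add: has_field_derivative_def mult_commute_abs)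
      have "DERIV \<psi> t :> s * ((b - a) \<bullet> G (a + t *\<^sub>R (b - a)) - G a \<bullet> (b - a))
          - l * t * (norm (b - a))\<^sup>2"
        unfolding \<psi>_def by (auto intro!: derivative_eq_intros d)
      moreover have "s * ((b - a) \<bullet> G (a + t *\<^sub>R (b - a)) - G a \<bullet> (b - a))
          - l * t * (norm (b - a))\<^sup>2 \<le> 0"
      proof -
        have "s * ((b - a) \<bullet> G (a + t *\<^sub>R (b - a)) - G a \<bullet> (b - a))
          \<le> \<bar>(G (a + t *\<^sub>R (b - a)) - G a) \<bullet> (b - a)\<bar>"
          using s by (auto simp: abs_if inner_diff_left inner_diff_right inner_commute split: if_splits)
        also have "\<dots>
            \<le> norm (G (a + t *\<^sub>R (b - a)) - G a) * norm (b - a)"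
          by (rule Cauchy_Schwarz_ineq2)
        also have "\<dots> \<le> (l * norm (t *\<^sub>R (b - a))) * norm (b - a)"
          using lipschitz[of "a + t *\<^sub>R (b - a)" a] by (intro mult_right_mono) auto
        also have "\<dots> = l * t * (norm (b - a))\<^sup>2"
          using t by (simp add: power2_eq_square)
        finally show ?thesis by simp
      qed
      ultimately show ?thesis by (intro exI conjI)
    qed
    have "\<psi> 1 \<le> \<psi> 0"
      by (rule DERIV_nonpos_imp_nonincreasing[OF zero_le_one *])
    then show ?thesis
      unfolding \<psi>_def by (simp add: right_diff_distrib)
  qed
  from upper[of 1] upper[of "-1"] show ?thesis by (intro abs_leI) simp_all
qed

end

text \<open>After rescaling, \<open>\<phi> = f\<^sub>i / \<eta>\<close> and \<open>\<zeta> = z\<^sub>i / \<eta>\<close>, so that the penalty parameter is \<open>1\<close>.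
  The equation for \<open>u\<close> says that \<open>u\<close> is the exact proximal point of \<open>x - \<zeta>\<close>.\<close>

definition aug_lagr :: "('a::real_inner \<Rightarrow> real) \<Rightarrow> 'a \<Rightarrow> 'a \<Rightarrow> 'a \<Rightarrow> real" where
  "aug_lagr \<phi> x \<zeta> b = \<phi> x - \<zeta> \<bullet> (b - x) + 1 / 2 * (norm (b - x))\<^sup>2"

definition near_resolvent :: "('a::real_inner \<Rightarrow> 'a) \<Rightarrow> 'a \<Rightarrow> 'a \<Rightarrow> real \<Rightarrow> bool" where
  "near_resolvent G \<zeta> x \<delta> \<longleftrightarrow> (\<exists>u. norm (x - u) \<le> \<delta> \<and> G u = x - u - \<zeta>)"

text \<open>Young's inequality; \<open>s\<close> decides which of the two squares is kept
  small.\<close>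

lemma mult_le_weighted_squares:
  fixes a b s :: real
  assumes "s > 0"
  shows "a * b \<le> s * a\<^sup>2 + b\<^sup>2 / (4 * s)"
proof -
  have "0 \<le> (2 * s * a - b)\<^sup>2 / (4 * s)" using assms by simp
  also have "\<dots> = s * a\<^sup>2 + b\<^sup>2 / (4 * s) - a * b"
    using assms by (simp add: field_simps power2_eq_square)
  finally show ?thesis by simp
qed

text \<open>Rests on \<open>1 - l - 2 * l\<^sup>2 = (1 - 2 * l) * (1 + l)\<close>. The bound on
  \<open>l\<close> keeps the augmented Lagrangian bounded below; the bound on
  \<open>\<gamma>\<close> lets squares with absolute coefficients be absorbed by multiples of
  \<open>1 / \<gamma>\<close>.\<close>

lemma parameter_bounds:
  fixes l \<gamma> :: real
  assumes l: "0 \<le> l" and \<gamma>: "0 < \<gamma>" and D: "0 < 1 - l - 2 * l\<^sup>2 - 4 * \<gamma> * (1 + l\<^sup>2)"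
  shows "2 * l < 1" "4 * \<gamma> \<le> 1"
proof -
  have "0 < \<gamma> * (1 + l\<^sup>2)"
    using \<gamma> by (simp add: add_pos_nonneg)
  then have "(1 - 2 * l) * (1 + l) > 0"
    using D by (simp add: power2_eq_square algebra_simps)
  with l show "2 * l < 1"
    by (simp add: zero_less_mult_iff)
  have "4 * \<gamma> * (1 + l\<^sup>2) = 4 * \<gamma> + 4 * (\<gamma> * l\<^sup>2)" "0 \<le> \<gamma> * l\<^sup>2" "0 \<le> l\<^sup>2"
    using \<gamma> by (simp_all add: algebra_simps)
  then show "4 * \<gamma> \<le> 1"
    using D l by linarith
qed

section \<open>Decrease, lower bound and residual of a single client\<close>

context smooth_fun
begin

text \<open>Expanding \<open>\<phi>\<close> around the exact new point \<open>w\<close> absorbs all terms linear in the errors into squares.\<close>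

lemma aug_lagr_step:
  assumes u: "G u = x - u - \<zeta>" and w: "G w = x' - w - \<zeta>'" and \<zeta>': "\<zeta>' = \<zeta> + (x' - b)"
  shows "aug_lagr \<phi> x' \<zeta>' b - aug_lagr \<phi> x \<zeta> b \<le>
    (1 + l) / 2 * (norm (x' - w))\<^sup>2 - (1 - l) / 2 * (norm (x - w))\<^sup>2
    + (norm (G w - G u + (x - u) - (x' - w)))\<^sup>2"
proof -
  \<comment> \<open>Subtracting the two proximal equations shows that this is
    \<open>\<zeta> - \<zeta>'\<close>. Written this way, the dual step is controlled by the
    displacement \<open>w - u\<close> and the two errors.\<close>
  have s: "G w - G u + (x - u) - (x' - w) = b - x'"
    using u w \<zeta>' by simp
  have "\<phi> x' \<le> \<phi> w + G w \<bullet> (x' - w) + l / 2 * (norm (x' - w))\<^sup>2"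
    using quadratic_bound[of x' w] by linarith
  moreover have "\<phi> x \<ge> \<phi> w + G w \<bullet> (x - w) - l / 2 * (norm (x - w))\<^sup>2"
    using quadratic_bound[of x w] by linarith
  \<comment> \<open>Once \<open>G w\<close> is replaced by its value, all inner products combine
    into squares exactly; the positive square of \<open>b - x'\<close> is the price of the dual
    update.\<close>
  moreover have "G w \<bullet> (x' - w) - G w \<bullet> (x - w) - \<zeta>' \<bullet> (b - x') + 1 / 2 * (norm (b - x'))\<^sup>2
      + \<zeta> \<bullet> (b - x) - 1 / 2 * (norm (b - x))\<^sup>2
      = 1 / 2 * (norm (x' - w))\<^sup>2 - 1 / 2 * (norm (x - w))\<^sup>2 + (norm (b - x'))\<^sup>2"
    unfolding w \<zeta>' by (simp add: power2_norm_eq_inner algebra_simps inner_commute)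
  ultimately show ?thesis
    unfolding aug_lagr_def s by (simp add: field_simps)
qed

text \<open>Everything is expressed by the displacement \<open>d\<close> of the exact proximal
  points and the errors \<open>e\<close>, \<open>e'\<close>. The result is a decrease of
  \<open>D / 2 * d\<^sup>2\<close>; since \<open>b - x = (w - u) + (G w - G u)\<close>, it bounds
  the distance to the server point, and \<open>(1 + l)\<^sup>2 \<le> 2 * (1 + l\<^sup>2)\<close>
  accounts for the denominator \<open>4 * (1 + l\<^sup>2)\<close>.\<close>

lemma aug_lagr_descent:
  assumes l: "0 \<le> l" and \<gamma>: "0 < \<gamma>" and D: "0 < D"
    and D_def: "D = 1 - l - 2 * l\<^sup>2 - 4 * \<gamma> * (1 + l\<^sup>2)"
    and near: "near_resolvent G \<zeta> x \<delta>" "near_resolvent G \<zeta>' x' \<delta>'"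
    and \<zeta>': "\<zeta>' = \<zeta> + (x' - b)"
  shows "aug_lagr \<phi> x' \<zeta>' b \<le> aug_lagr \<phi> x \<zeta> b - D / (4 * (1 + l\<^sup>2)) * (norm (b - x))\<^sup>2
     + (1 + l)\<^sup>2 / \<gamma> * \<delta>\<^sup>2 + (1 + l)\<^sup>2 / \<gamma> * \<delta>'\<^sup>2"
proof -
  obtain u w where u: "G u = x - u - \<zeta>" "norm (x - u) \<le> \<delta>"
      and w: "G w = x' - w - \<zeta>'" "norm (x' - w) \<le> \<delta>'"
    using near by (auto simp: near_resolvent_def)
  define d e e' where "d = norm (w - u)" and "e = norm (x - u)" and "e' = norm (x' - w)"
  have nonneg: "0 \<le> d" "0 \<le> e" "0 \<le> e'" by (auto simp: d_def e_def e'_def)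
  have l2: "2 * l < 1" and \<gamma>4: "4 * \<gamma> \<le> 1"
    using parameter_bounds[OF l \<gamma>] D D_def by auto
  have q: "norm (G w - G u) \<le> l * d"
    using lipschitz[of w u] by (simp add: d_def)
  have "norm (b - x) \<le> (1 + l) * d"
  proof -
    have "b - x = (w - u) + (G w - G u)"
      using u w \<zeta>' by simp
    then have "norm (b - x) \<le> d + norm (G w - G u)"
      unfolding d_def by (metis norm_triangle_ineq)
    with q show ?thesis by (simp add: algebra_simps)
  qed
  then have "(norm (b - x))\<^sup>2 \<le> ((1 + l) * d)\<^sup>2"
    by (intro power_mono) auto
  also have "\<dots> \<le> 2 * (1 + l\<^sup>2) * d\<^sup>2"
    using mult_right_mono[of "(1 + l)\<^sup>2" "2 * (1 + l\<^sup>2)" "d\<^sup>2"]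
      zero_le_power2[of "1 - l"] by (simp add: power_mult_distrib power2_eq_square algebra_simps)
  finally have "D / (4 * (1 + l\<^sup>2)) * (norm (b - x))\<^sup>2 \<le> D / (4 * (1 + l\<^sup>2)) * (2 * (1 + l\<^sup>2) * d\<^sup>2)"
    using D by (intro mult_left_mono) auto
  also have "\<dots> = D / 2 * d\<^sup>2"
    by (simp add: add_nonneg_eq_0_iff divide_simps)
  finally have v: "D / (4 * (1 + l\<^sup>2)) * (norm (b - x))\<^sup>2 \<le> D / 2 * d\<^sup>2" .
  have xw: "(d - e)\<^sup>2 \<le> (norm (x - w))\<^sup>2"
  proof -
    have "\<bar>norm (w - u) - norm (x - u)\<bar> \<le> norm ((w - u) - (x - u))"
      by (rule norm_triangle_ineq3)
    then have "\<bar>d - e\<bar> \<le> norm (x - w)"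
      by (simp add: d_def e_def norm_minus_commute)
    then show ?thesis
      using abs_le_square_iff[of "d - e" "norm (x - w)"] by simp
  qed
  have "norm (G w - G u + (x - u) - (x' - w)) \<le> l * d + e + e'"
  proof -
    have "norm (G w - G u + (x - u) - (x' - w)) \<le> norm (G w - G u) + norm (x - u) + norm (x' - w)"
      using norm_triangle_ineq4[of "G w - G u + (x - u)" "x' - w"]
        norm_triangle_ineq[of "G w - G u" "x - u"] by linarith
    with q show ?thesis by (simp add: e_def e'_def)
  qed
  then have s: "(norm (G w - G u + (x - u) - (x' - w)))\<^sup>2 \<le> (l * d + e + e')\<^sup>2"
    by (intro power_mono) auto
  \<comment> \<open>Each cross term may cost \<open>\<gamma> * d\<^sup>2\<close>. Together they stay
    within the \<open>2 * \<gamma> * (1 + l\<^sup>2) * d\<^sup>2\<close> reserved in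
    \<open>D / 2 * d\<^sup>2\<close>.\<close>
  have y1: "d * ((1 + l) * e) \<le> \<gamma> * d\<^sup>2 + ((1 + l) * e)\<^sup>2 / (4 * \<gamma>)"
    and y2: "d * (2 * l * e') \<le> \<gamma> * d\<^sup>2 + (2 * l * e')\<^sup>2 / (4 * \<gamma>)"
    by (rule mult_le_weighted_squares[OF \<gamma>])+
  have "2 * e * e' \<le> e\<^sup>2 + e'\<^sup>2"
    by (rule sum_squares_bound)
  have \<gamma>i: "4 \<le> 1 / \<gamma>" using \<gamma> \<gamma>4 by (simp add: field_simps)
  have core: "(1 + l) / 2 * e'\<^sup>2 - (1 - l) / 2 * (d - e)\<^sup>2 + (l * d + e + e')\<^sup>2
     \<le> - (D / 2) * d\<^sup>2 + (1 + l)\<^sup>2 / \<gamma> * e\<^sup>2 + (1 + l)\<^sup>2 / \<gamma> * e'\<^sup>2"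
  proof -
    have "(1 + l) / 2 * e'\<^sup>2 - (1 - l) / 2 * (d - e)\<^sup>2 + (l * d + e + e')\<^sup>2
      = - ((1 - l - 2 * l\<^sup>2) / 2) * d\<^sup>2 + d * ((1 + l) * e) + d * (2 * l * e')
        + 2 * e * e' + (1 + l) / 2 * e\<^sup>2 + (3 + l) / 2 * e'\<^sup>2"
      by (simp add: power2_eq_square field_simps)
    also have "\<dots> \<le> - ((1 - l - 2 * l\<^sup>2) / 2) * d\<^sup>2 + 2 * \<gamma> * d\<^sup>2
        + ((1 + l)\<^sup>2 / (4 * \<gamma>) + (3 + l) / 2) * e\<^sup>2
        + (l\<^sup>2 / \<gamma> + (5 + l) / 2) * e'\<^sup>2"
    proof -
      have "((1 + l)\<^sup>2 / (4 * \<gamma>) + (3 + l) / 2) * e\<^sup>2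
          = ((1 + l) * e)\<^sup>2 / (4 * \<gamma>) + e\<^sup>2 + (1 + l) / 2 * e\<^sup>2"
        "(l\<^sup>2 / \<gamma> + (5 + l) / 2) * e'\<^sup>2 = (2 * l * e')\<^sup>2 / (4 * \<gamma>) + e'\<^sup>2 + (3 + l) / 2 * e'\<^sup>2"
        unfolding power_mult_distrib by (simp_all add: field_simps)
      with y1 y2 \<open>2 * e * e' \<le> e\<^sup>2 + e'\<^sup>2\<close> show ?thesis by linarith
    qed
    also have "\<dots> \<le> - (D / 2) * d\<^sup>2 + (1 + l)\<^sup>2 / \<gamma> * e\<^sup>2 + (1 + l)\<^sup>2 / \<gamma> * e'\<^sup>2"
    proof (intro add_mono mult_right_mono)
      have "- ((1 - l - 2 * l\<^sup>2) / 2) * d\<^sup>2 + 2 * \<gamma> * d\<^sup>2 = - (D / 2) * d\<^sup>2 - 2 * \<gamma> * (l * d)\<^sup>2"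
        unfolding D_def by (simp add: field_simps power2_eq_square)
      then show "- ((1 - l - 2 * l\<^sup>2) / 2) * d\<^sup>2 + 2 * \<gamma> * d\<^sup>2 \<le> - (D / 2) * d\<^sup>2"
        using \<gamma> by simp
      \<comment> \<open>Young's inequality has used a quarter of
        \<open>(1 + l)\<^sup>2 / \<gamma>\<close> for \<open>e\<close>, and
        \<open>l\<^sup>2 / \<gamma>\<close> for \<open>e'\<close>. What remains covers the plain
        squares because \<open>1 / \<gamma>\<close> is at least 4.\<close>
      have "(3 + l) / 2 \<le> 3 / 4 * (1 + l)\<^sup>2 * 4"
        using l by (simp add: power2_eq_square algebra_simps)
      also have "\<dots> \<le> 3 / 4 * (1 + l)\<^sup>2 * (1 / \<gamma>)"
        using \<gamma>i by (intro mult_left_mono) auto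
      also have "\<dots> = (1 + l)\<^sup>2 / \<gamma> - (1 + l)\<^sup>2 / (4 * \<gamma>)"
        by (simp add: field_simps)
      finally show "(1 + l)\<^sup>2 / (4 * \<gamma>) + (3 + l) / 2 \<le> (1 + l)\<^sup>2 / \<gamma>"
        by linarith
      have "(5 + l) / 2 \<le> (1 + 2 * l) * 4"
        using l by simp
      also have "\<dots> \<le> (1 + 2 * l) * (1 / \<gamma>)"
        using \<gamma>i l by (intro mult_left_mono) auto
      also have "\<dots> = (1 + l)\<^sup>2 / \<gamma> - l\<^sup>2 / \<gamma>"
        by (simp add: add_divide_distrib power2_eq_square algebra_simps)
      finally show "l\<^sup>2 / \<gamma> + (5 + l) / 2 \<le> (1 + l)\<^sup>2 / \<gamma>"
        by linarith
    qed simp_all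
    finally show ?thesis .
  qed
  have "(1 + l)\<^sup>2 / \<gamma> * e\<^sup>2 \<le> (1 + l)\<^sup>2 / \<gamma> * \<delta>\<^sup>2" "(1 + l)\<^sup>2 / \<gamma> * e'\<^sup>2 \<le> (1 + l)\<^sup>2 / \<gamma> * \<delta>'\<^sup>2"
    using u(2) w(2) nonneg \<gamma> by (intro mult_left_mono power_mono; simp add: e_def e'_def)+
  moreover have "(1 - l) / 2 * (d - e)\<^sup>2 \<le> (1 - l) / 2 * (norm (x - w))\<^sup>2"
    using l2 l xw by (intro mult_left_mono) auto
  ultimately show ?thesis
    using aug_lagr_step[OF u(1) w(1) \<zeta>'] s v core unfolding e'_def[symmetric] by linarith
qed

text \<open>Both \<open>\<phi> x\<close> and \<open>\<phi> b\<close> are expanded around the exact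
  point \<open>u\<close>, where the gradient is known. The constant is
  \<open>1/20 = 1/2 - 1/4 - 1/5\<close>: a quarter goes to the smoothness term, a fifth to the cross
  term \<open>3 / 2 * (e * v)\<close>. The error terms add up to less than 4.\<close>

lemma aug_lagr_lower:
  assumes l: "0 \<le> l" "l \<le> 1 / 2" and near: "near_resolvent G \<zeta> x \<delta>"
  shows "\<phi> b + 1 / 20 * (norm (b - x))\<^sup>2 - 4 * \<delta>\<^sup>2 \<le> aug_lagr \<phi> x \<zeta> b"
proof -
  obtain u where u: "G u = x - u - \<zeta>" "norm (x - u) \<le> \<delta>"
    using near by (auto simp: near_resolvent_def)
  define v e where "v = norm (b - x)" and "e = norm (x - u)"
  have "\<phi> x \<ge> \<phi> u + G u \<bullet> (x - u) - l / 2 * e\<^sup>2"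
    using quadratic_bound[of x u] unfolding e_def by linarith
  moreover have "\<phi> b \<le> \<phi> u + G u \<bullet> (b - u) + l / 2 * (norm (b - u))\<^sup>2"
    using quadratic_bound[of b u] by linarith
  moreover have "G u \<bullet> (x - u) - G u \<bullet> (b - u) - \<zeta> \<bullet> (b - x) = - ((x - u) \<bullet> (b - x))"
    unfolding u(1) by (simp add: algebra_simps inner_commute)
  ultimately have "aug_lagr \<phi> x \<zeta> b \<ge> \<phi> b - (x - u) \<bullet> (b - x) + 1 / 2 * v\<^sup>2
      - l / 2 * e\<^sup>2 - l / 2 * (norm (b - u))\<^sup>2"
    unfolding aug_lagr_def v_def by linarith
  moreover have "(x - u) \<bullet> (b - x) \<le> e * v"
    unfolding e_def v_def by (rule norm_cauchy_schwarz)
  moreover have "l / 2 * (norm (b - u))\<^sup>2 \<le> 1 / 4 * (v + e)\<^sup>2"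
  proof (rule mult_mono)
    show "(norm (b - u))\<^sup>2 \<le> (v + e)\<^sup>2"
      unfolding v_def e_def using norm_triangle_ineq[of "b - x" "x - u"] by (intro power_mono) auto
  qed (use l in auto)
  moreover have "l / 2 * e\<^sup>2 \<le> 1 / 4 * e\<^sup>2"
    using l by (intro mult_right_mono) auto
  moreover have "3 / 2 * (e * v) \<le> 1 / 5 * v\<^sup>2 + 45 / 16 * e\<^sup>2"
    using mult_le_weighted_squares[of "1 / 5" v "3 / 2 * e"] by (simp add: power_mult_distrib field_simps)
  moreover have "e\<^sup>2 \<le> \<delta>\<^sup>2"
    using u(2) unfolding e_def by (intro power_mono) auto
  moreover have "0 \<le> \<delta>\<^sup>2"
    by simp
  moreover have "(v + e)\<^sup>2 = v\<^sup>2 + 2 * (e * v) + e\<^sup>2"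
    by (simp add: power2_eq_square algebra_simps)
  ultimately show ?thesis
    unfolding v_def[symmetric] by linarith
qed

text \<open>The vector on the left is the share of one client in the sum of the gradients at
  \<open>b\<close>: summed over the clients, \<open>\<zeta> + x - b\<close> cancels when
  \<open>b\<close> is the average of the \<open>x + \<zeta>\<close>.\<close>

lemma residual_bound:
  assumes l: "0 \<le> l" and near: "near_resolvent G \<zeta> x \<delta>"
  shows "norm (G b + \<zeta> + x - b) \<le> (1 + l) * (norm (b - x) + \<delta>)"
proof -
  obtain u where u: "G u = x - u - \<zeta>" "norm (x - u) \<le> \<delta>"
    using near by (auto simp: near_resolvent_def)
  have "G b + \<zeta> + x - b = (G b - G x) + (G x - G u) + ((x - u) - (b - x))"
    using u(1) by simp
  also have "norm \<dots> \<le> norm (G b - G x) + norm (G x - G u) + (norm (x - u) + norm (b - x))"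
    by (intro norm_triangle_mono norm_triangle_ineq norm_triangle_ineq4 order_refl)
  also have "\<dots> \<le> l * norm (b - x) + l * norm (x - u) + (norm (x - u) + norm (b - x))"
    by (intro add_mono lipschitz order_refl)
  also have "\<dots> = (1 + l) * (norm (b - x) + norm (x - u))"
    by (simp add: algebra_simps)
  also have "\<dots> \<le> (1 + l) * (norm (b - x) + \<delta>)"
    using u(2) l by (intro mult_left_mono) auto
  finally show ?thesis .
qed

end

section \<open>Means and independent indicators\<close>

lemma sum_norm_diff_mean_le:
  fixes a :: "'i \<Rightarrow> 'a::real_inner"
  assumes "finite I" and c: "real (card I) *\<^sub>R c = (\<Sum>i\<in>I. a i)"
  shows "(\<Sum>i\<in>I. (norm (c - a i))\<^sup>2) \<le> (\<Sum>i\<in>I. (norm (b - a i))\<^sup>2)"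
proof -
  have "(norm (b - a i))\<^sup>2 = (norm (c - a i))\<^sup>2 + (norm (b - c))\<^sup>2 + 2 * ((b - c) \<bullet> (c - a i))" for i
    by (simp add: power2_norm_eq_inner inner_diff_left inner_diff_right inner_commute)
  then have "(\<Sum>i\<in>I. (norm (b - a i))\<^sup>2) = (\<Sum>i\<in>I. (norm (c - a i))\<^sup>2)
      + real (card I) * (norm (b - c))\<^sup>2 + 2 * ((b - c) \<bullet> (\<Sum>i\<in>I. c - a i))"
    by (simp add: sum.distrib sum_distrib_left inner_sum_right)
  moreover have "(\<Sum>i\<in>I. c - a i) = 0"
    by (simp add: sum_subtractf sum_constant_scaleR c[symmetric])
  ultimately show ?thesis by simp
qed

text \<open>Replaces the activity indicator of a client by its inclusion probability. The hypothesis
  concerns a whole \<sigma>-algebra \<open>N\<close>; it passes to real random variables because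
  those generated by \<open>Z\<close> and \<open>Y\<close> lie inside the one generated by
  \<open>X\<close> and inside \<open>N\<close>.\<close>

lemma (in prob_space) expectation_indicator_indep:
  fixes Y :: "'a \<Rightarrow> real"
  assumes indep: "indep_set (sets N) (sets (vimage_algebra (space M) X (count_space UNIV)))"
    and sub: "subalgebra M N"
    and Y: "Y \<in> borel_measurable N" "integrable M Y"
  shows "(\<integral>\<omega>. indicator B (X \<omega>) * Y \<omega> \<partial>M) = prob {\<omega>\<in>space M. X \<omega> \<in> B} * expectation Y"
    and "integrable M (\<lambda>\<omega>. indicator B (X \<omega>) * Y \<omega>)"
proof -
  define Z :: "'a \<Rightarrow> real" where "Z \<omega> = indicator B (X \<omega>)" for \<omega>
  define V where "V = vimage_algebra (space M) X (count_space UNIV)"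
  have X: "X \<in> measurable V (count_space UNIV)"
    unfolding V_def by (rule measurable_vimage_algebra1) simp
  have V: "sets V \<subseteq> events" "space V = space M"
    using indep unfolding V_def indep_sets2_eq by auto
  then have subV: "subalgebra M V"
    by (simp add: subalgebra_def)
  have Z: "Z \<in> borel_measurable V"
    unfolding Z_def by (rule measurable_compose[OF X]) simp
  have ZM: "Z \<in> borel_measurable M"
    by (rule measurable_from_subalg[OF subV Z])
  have iZ: "integrable M Z"
    by (rule integrable_const_bound[where B=1]) (use ZM in \<open>auto simp: Z_def\<close>)
  have ind: "indep_var borel Z borel Y"
    unfolding indep_var_eq
  proof (intro conjI)
    show "random_variable borel Y"
      by (rule measurable_from_subalg[OF sub Y(1)])
    have "{Z -` S \<inter> space M |S. S \<in> sets borel} \<subseteq> sets V"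
      using measurable_sets[OF Z] V(2) by auto
    then have "sigma_sets (space M) {Z -` S \<inter> space M |S. S \<in> sets borel} \<subseteq> sets V"
      using sets.sigma_sets_subset[of _ V] V(2) by simp
    moreover have "{Y -` S \<inter> space M |S. S \<in> sets borel} \<subseteq> sets N"
      using measurable_sets[OF Y(1)] sub by (auto simp: subalgebra_def)
    then have "sigma_sets (space M) {Y -` S \<inter> space M |S. S \<in> sets borel} \<subseteq> sets N"
      using sets.sigma_sets_subset[of _ N] sub by (simp add: subalgebra_def)
    ultimately show "indep_set (sigma_sets (space M) {Z -` S \<inter> space M |S. S \<in> sets borel})
        (sigma_sets (space M) {Y -` S \<inter> space M |S. S \<in> sets borel})"
      using indep unfolding indep_sets2_eq V_def[symmetric]
      by (metis (no_types, lifting) Int_commute mult.commute subset_iff)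
  qed (fact ZM)
  have "expectation Z = prob {\<omega>\<in>space M. X \<omega> \<in> B}"
  proof -
    have "expectation Z = (\<integral>\<omega>. indicator {\<omega>\<in>space M. X \<omega> \<in> B} \<omega> \<partial>M)"
      by (intro Bochner_Integration.integral_cong) (auto simp: Z_def indicator_def)
    then show ?thesis by (auto simp: Int_def intro!: arg_cong[where f=prob])
  qed
  then show "(\<integral>\<omega>. indicator B (X \<omega>) * Y \<omega> \<partial>M) = prob {\<omega>\<in>space M. X \<omega> \<in> B} * expectation Y"
    using indep_var_lebesgue_integral[OF ind iZ Y(2)] by (simp add: Z_def[abs_def])
  show "integrable M (\<lambda>\<omega>. indicator B (X \<omega>) * Y \<omega>)"
    using indep_var_integrable[OF ind iZ Y(2)] by (simp add: Z_def)
qed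

section \<open>The potential of all clients\<close>

text \<open>The instance for FedADMM takes \<open>L / \<eta>\<close> for \<open>l\<close>,
  \<open>\<gamma>4\<close> for \<open>\<gamma>\<close> and \<open>\<gamma>1\<close> for
  \<open>\<theta>\<close>.\<close>

locale clients =
  fixes I :: "'i set" and \<phi> :: "'i \<Rightarrow> 'a::real_inner \<Rightarrow> real" and G :: "'i \<Rightarrow> 'a \<Rightarrow> 'a"
    and l \<gamma> \<theta> :: real
  assumes finite_I: "finite I"
    and smooth: "i \<in> I \<Longrightarrow> smooth_fun (\<phi> i) (G i) l"
    and l_nonneg: "0 \<le> l" and \<gamma>_pos: "0 < \<gamma>" and \<theta>_pos: "0 < \<theta>"
    and margin: "0 < 1 - l - 2 * l\<^sup>2 - 4 * \<gamma> * (1 + l\<^sup>2)"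
begin

definition \<kappa> :: real where
  "\<kappa> = (1 - l - 2 * l\<^sup>2 - 4 * \<gamma> * (1 + l\<^sup>2)) / (4 * (1 + l\<^sup>2))"

definition err :: real where
  "err = (1 + l)\<^sup>2 / \<gamma>"

text \<open>When a client becomes active its stored square is released: the part \<open>err\<close>
  pays for the old inexactness in the descent estimate, and the part
  \<open>\<kappa> / \<theta>\<close> remains as gain.\<close>

definition potential :: "('i \<Rightarrow> 'a) \<Rightarrow> ('i \<Rightarrow> 'a) \<Rightarrow> 'a \<Rightarrow> ('i \<Rightarrow> real) \<Rightarrow> real" where
  "potential x \<zeta> b \<tau> = (\<Sum>i\<in>I. aug_lagr (\<phi> i) (x i) (\<zeta> i) b + (err + \<kappa> / \<theta>) * (\<tau> i)\<^sup>2)"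

text \<open>The weights are matched to \<open>(v + \<tau>)\<^sup>2 \<le> (1 + \<theta>) * (v\<^sup>2
  + \<tau>\<^sup>2 / \<theta>)\<close>, which makes the gain control the squared residual.\<close>

definition gain :: "'a \<Rightarrow> 'a \<Rightarrow> real \<Rightarrow> real" where
  "gain x b \<tau> = \<kappa> * (norm (b - x))\<^sup>2 + \<kappa> / \<theta> * \<tau>\<^sup>2"

lemma \<kappa>_pos: "0 < \<kappa>"
  using margin unfolding \<kappa>_def by (simp add: add_pos_nonneg)

lemma gain_nonneg: "0 \<le> gain x b \<tau>"
  using \<kappa>_pos \<theta>_pos by (simp add: gain_def)

text \<open>The number 4 is the loss in \<open>aug_lagr_lower\<close>; thus the \<open>err\<close>
  part of the potential already compensates it.\<close>

lemma err_ge: "4 \<le> err"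
proof -
  have "4 * \<gamma> \<le> 1"
    using parameter_bounds(2)[OF l_nonneg \<gamma>_pos margin] .
  also have "1 \<le> (1 + l)\<^sup>2"
    using l_nonneg by (simp add: power2_eq_square algebra_simps)
  finally show ?thesis
    using \<gamma>_pos by (simp add: err_def field_simps)
qed

lemma potential_lower:
  assumes near: "\<And>i. i \<in> I \<Longrightarrow> near_resolvent (G i) (\<zeta> i) (x i) (\<tau> i)"
  shows "(\<Sum>i\<in>I. \<phi> i b) + (\<Sum>i\<in>I. 1 / 20 * (norm (b - x i))\<^sup>2 + \<kappa> / \<theta> * (\<tau> i)\<^sup>2) \<le> potential x \<zeta> b \<tau>"
  unfolding potential_def sum.distrib[symmetric]
proof (rule sum_mono)
  fix i assume i: "i \<in> I"
  interpret smooth_fun "\<phi> i" "G i" l by (rule smooth[OF i])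
  have "4 * (\<tau> i)\<^sup>2 \<le> err * (\<tau> i)\<^sup>2"
    using err_ge by (intro mult_right_mono) auto
  then show "\<phi> i b + (1 / 20 * (norm (b - x i))\<^sup>2 + \<kappa> / \<theta> * (\<tau> i)\<^sup>2)
      \<le> aug_lagr (\<phi> i) (x i) (\<zeta> i) b + (err + \<kappa> / \<theta>) * (\<tau> i)\<^sup>2"
    using aug_lagr_lower[OF l_nonneg _ near[OF i], of b] parameter_bounds(1)[OF l_nonneg \<gamma>_pos margin]
    by (simp add: distrib_right)
qed

text \<open>Completing the square: up to a constant, the dependence on the server point is half the
  squared distance to \<open>x i + \<zeta> i\<close>, and the mean minimizes a sum of squared
  distances.\<close>

lemma sum_aug_lagr_mean_le:
  assumes "real (card I) *\<^sub>R c = (\<Sum>i\<in>I. x i + \<zeta> i)"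
  shows "(\<Sum>i\<in>I. aug_lagr (\<phi> i) (x i) (\<zeta> i) c) \<le> (\<Sum>i\<in>I. aug_lagr (\<phi> i) (x i) (\<zeta> i) b)"
proof -
  have "aug_lagr (\<phi> i) (x i) (\<zeta> i) b
      = \<phi> i (x i) - 1 / 2 * (norm (\<zeta> i))\<^sup>2 + 1 / 2 * (norm (b - (x i + \<zeta> i)))\<^sup>2" for i b
    by (simp add: aug_lagr_def power2_norm_eq_inner algebra_simps inner_commute)
  then show ?thesis
    using sum_norm_diff_mean_le[OF finite_I assms, of b]
    by (simp add: sum.distrib sum_distrib_left[symmetric] sum_divide_distrib[symmetric])
qed

text \<open>Moving the server to the new average only helps, so it suffices to compare client by
  client at the old \<open>b\<close>. A new tolerance costs \<open>err\<close> in the descent and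
  \<open>err + \<kappa> / \<theta>\<close> for storing it. The bracket after the indicator contains
  no new iterate.\<close>

lemma potential_step:
  assumes A: "A \<subseteq> I"
    and near: "\<And>i. i \<in> A \<Longrightarrow> near_resolvent (G i) (\<zeta> i) (x i) (\<tau> i)"
      "\<And>i. i \<in> A \<Longrightarrow> near_resolvent (G i) (\<zeta>' i) (x' i) (\<epsilon> i)"
    and \<zeta>': "\<And>i. i \<in> A \<Longrightarrow> \<zeta>' i = \<zeta> i + (x' i - b)"
    and idle: "\<And>i. i \<in> I - A \<Longrightarrow> x' i = x i \<and> \<zeta>' i = \<zeta> i"
    and \<tau>': "\<And>i. i \<in> I \<Longrightarrow> \<tau>' i = (if i \<in> A then \<epsilon> i else \<tau> i)"
    and b': "real (card I) *\<^sub>R b' = (\<Sum>i\<in>I. x' i + \<zeta>' i)"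
  shows "potential x' \<zeta>' b' \<tau>' \<le> potential x \<zeta> b \<tau>
    + (\<Sum>i\<in>I. indicator A i * ((2 * err + \<kappa> / \<theta>) * (\<epsilon> i)\<^sup>2 - gain (x i) b (\<tau> i)))"
proof -
  have "potential x' \<zeta>' b' \<tau>' \<le> potential x' \<zeta>' b \<tau>'"
    using sum_aug_lagr_mean_le[OF b', of b] by (simp add: potential_def sum.distrib)
  also have "\<dots> \<le> potential x \<zeta> b \<tau>
    + (\<Sum>i\<in>I. indicator A i * ((2 * err + \<kappa> / \<theta>) * (\<epsilon> i)\<^sup>2 - gain (x i) b (\<tau> i)))"
    unfolding potential_def sum.distrib[symmetric]
  proof (rule sum_mono)
    fix i assume i: "i \<in> I"
    interpret smooth_fun "\<phi> i" "G i" l by (rule smooth[OF i])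
    show "aug_lagr (\<phi> i) (x' i) (\<zeta>' i) b + (err + \<kappa> / \<theta>) * (\<tau>' i)\<^sup>2
      \<le> aug_lagr (\<phi> i) (x i) (\<zeta> i) b + (err + \<kappa> / \<theta>) * (\<tau> i)\<^sup>2
        + indicator A i * ((2 * err + \<kappa> / \<theta>) * (\<epsilon> i)\<^sup>2 - gain (x i) b (\<tau> i))"
    proof (cases "i \<in> A")
      case True
      have "aug_lagr (\<phi> i) (x' i) (\<zeta>' i) b \<le> aug_lagr (\<phi> i) (x i) (\<zeta> i) b
          - \<kappa> * (norm (b - x i))\<^sup>2 + err * (\<tau> i)\<^sup>2 + err * (\<epsilon> i)\<^sup>2"
        unfolding \<kappa>_def err_def
        by (rule aug_lagr_descent[OF l_nonneg \<gamma>_pos margin refl near(1)[OF True] near(2)[OF True] \<zeta>'[OF True]])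
      then show ?thesis
        using True \<tau>'[OF i] by (simp add: gain_def algebra_simps)
    next
      case False
      then show ?thesis using i idle \<tau>' by simp
    qed
  qed
  finally show ?thesis .
qed

lemma gradient_sum_bound:
  assumes near: "\<And>i. i \<in> I \<Longrightarrow> near_resolvent (G i) (\<zeta> i) (x i) (\<tau> i)"
    and b: "real (card I) *\<^sub>R b = (\<Sum>i\<in>I. x i + \<zeta> i)"
  shows "\<kappa> / (1 + \<theta>) * (norm (\<Sum>i\<in>I. G i b))\<^sup>2
    \<le> real (card I) * (1 + l)\<^sup>2 * (\<Sum>i\<in>I. gain (x i) b (\<tau> i))"
proof -
  have "(\<Sum>i\<in>I. G i b) = (\<Sum>i\<in>I. G i b + \<zeta> i + x i - b)"
    using b by (simp add: sum.distrib sum_subtractf sum_constant_scaleR algebra_simps)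
  also have "norm \<dots> \<le> (\<Sum>i\<in>I. norm (G i b + \<zeta> i + x i - b))"
    by (rule norm_sum)
  finally have "(norm (\<Sum>i\<in>I. G i b))\<^sup>2 \<le> (\<Sum>i\<in>I. norm (G i b + \<zeta> i + x i - b))\<^sup>2"
    by (intro power_mono) auto
  also have "\<dots> \<le> (\<Sum>i\<in>I. (norm (G i b + \<zeta> i + x i - b))\<^sup>2) * real (card I)"
    using sum_squared_le_sum_of_squares by blast
  finally have "\<kappa> / (1 + \<theta>) * (norm (\<Sum>i\<in>I. G i b))\<^sup>2
      \<le> \<kappa> / (1 + \<theta>) * ((\<Sum>i\<in>I. (norm (G i b + \<zeta> i + x i - b))\<^sup>2) * real (card I))"
    using \<kappa>_pos \<theta>_pos by (intro mult_left_mono) auto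
  also have "\<dots> = real (card I) * (\<Sum>i\<in>I. \<kappa> / (1 + \<theta>) * (norm (G i b + \<zeta> i + x i - b))\<^sup>2)"
    unfolding sum_distrib_left[symmetric] by (simp only: mult_ac)
  also have "\<dots> \<le> real (card I) * (\<Sum>i\<in>I. (1 + l)\<^sup>2 * gain (x i) b (\<tau> i))"
  proof (intro mult_left_mono sum_mono)
    fix i assume i: "i \<in> I"
    interpret smooth_fun "\<phi> i" "G i" l by (rule smooth[OF i])
    define v where "v = norm (b - x i)"
    have "(norm (G i b + \<zeta> i + x i - b))\<^sup>2 \<le> ((1 + l) * (v + \<tau> i))\<^sup>2"
      unfolding v_def using residual_bound[OF l_nonneg near[OF i], of b] by (intro power_mono) auto
    also have "\<dots> = (1 + l)\<^sup>2 * (v\<^sup>2 + \<tau> i * (2 * v) + (\<tau> i)\<^sup>2)"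
      by (simp add: power2_eq_square algebra_simps)
    \<comment> \<open>The weight \<open>1 / \<theta>\<close> makes both squares come out as
      \<open>1 + \<theta>\<close> times their weights in \<open>gain\<close>, hence the factor
      \<open>1 + \<gamma>1\<close> in the denominator of \<open>\<beta>\<close>.\<close>
    also have "\<dots> \<le> (1 + l)\<^sup>2 * (v\<^sup>2 + (1 / \<theta> * (\<tau> i)\<^sup>2 + \<theta> * v\<^sup>2) + (\<tau> i)\<^sup>2)"
      using mult_le_weighted_squares[of "1 / \<theta>" "\<tau> i" "2 * v"] \<theta>_pos
      by (intro mult_left_mono add_mono order_refl) (auto simp: power_mult_distrib mult.commute)
    also have "\<dots> = (1 + l)\<^sup>2 * ((1 + \<theta>) * (v\<^sup>2 + 1 / \<theta> * (\<tau> i)\<^sup>2))"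
      using \<theta>_pos by (simp add: field_simps)
    finally have "\<kappa> / (1 + \<theta>) * (norm (G i b + \<zeta> i + x i - b))\<^sup>2
        \<le> \<kappa> / (1 + \<theta>) * ((1 + l)\<^sup>2 * ((1 + \<theta>) * (v\<^sup>2 + 1 / \<theta> * (\<tau> i)\<^sup>2)))"
      using \<kappa>_pos \<theta>_pos by (intro mult_left_mono) auto
    also have "\<dots> = (1 + l)\<^sup>2 * (\<kappa> * (v\<^sup>2 + 1 / \<theta> * (\<tau> i)\<^sup>2))"
      using \<theta>_pos by simp
    also have "\<dots> = (1 + l)\<^sup>2 * gain (x i) b (\<tau> i)"
      by (simp add: gain_def v_def distrib_left)
    finally show "\<kappa> / (1 + \<theta>) * (norm (G i b + \<zeta> i + x i - b))\<^sup>2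
        \<le> (1 + l)\<^sup>2 * gain (x i) b (\<tau> i)" .
  qed simp
  finally show ?thesis
    by (simp add: sum_distrib_left[symmetric])
qed

end

section \<open>Random participation\<close>

text \<open>The hat and tilde variables are eliminated: \<open>server\<close> states the average
  directly in terms of \<open>x + \<zeta>\<close>. The assumption \<open>init_near\<close> gives
  meaning to the tolerance at index 0, which a client keeps until its first activation.\<close>

locale random_clients = clients I \<phi> G l \<gamma> \<theta> + prob_space M
  for I :: "'i set" and \<phi> :: "'i \<Rightarrow> 'a::euclidean_space \<Rightarrow> real" and G l \<gamma> \<theta> and M :: "'w measure" +
  fixes H :: "nat \<Rightarrow> 'w measure" and K :: nat and A :: "nat \<Rightarrow> 'w \<Rightarrow> 'i set"
    and x \<zeta> :: "nat \<Rightarrow> 'w \<Rightarrow> 'i \<Rightarrow> 'a" and b :: "nat \<Rightarrow> 'w \<Rightarrow> 'a"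
    and \<epsilon> :: "nat \<Rightarrow> 'i \<Rightarrow> real" and x0 :: 'a and F_min :: real
  assumes filtration: "filtration (space M) H"
    and subalg: "subalgebra M (H k)"
    and x_meas: "k \<le> Suc K \<Longrightarrow> i \<in> I \<Longrightarrow> (\<lambda>\<omega>. x k \<omega> i) \<in> borel_measurable (H k)"
    and \<zeta>_meas: "k \<le> Suc K \<Longrightarrow> i \<in> I \<Longrightarrow> (\<lambda>\<omega>. \<zeta> k \<omega> i) \<in> borel_measurable (H k)"
    and b_meas: "k \<le> Suc K \<Longrightarrow> b k \<in> borel_measurable (H k)"
    and A_meas: "k \<le> K \<Longrightarrow> A k \<in> measurable (H (Suc k)) (count_space UNIV)"
    and A_indep: "k \<le> K \<Longrightarrow>
      indep_set (sets (H k)) (sets (vimage_algebra (space M) (A k) (count_space UNIV)))"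
    and A_sub: "k \<le> K \<Longrightarrow> \<omega> \<in> space M \<Longrightarrow> A k \<omega> \<subseteq> I"
    and init: "\<omega> \<in> space M \<Longrightarrow> b 0 \<omega> = x0"
      "\<omega> \<in> space M \<Longrightarrow> i \<in> I \<Longrightarrow> x 0 \<omega> i = x0"
      "\<omega> \<in> space M \<Longrightarrow> i \<in> I \<Longrightarrow> \<zeta> 0 \<omega> i = 0"
    and init_near: "i \<in> I \<Longrightarrow> near_resolvent (G i) 0 x0 (\<epsilon> 0 i)"
    and near_step: "k \<le> K \<Longrightarrow> \<omega> \<in> space M \<Longrightarrow> i \<in> A k \<omega> \<Longrightarrow>
      near_resolvent (G i) (\<zeta> (Suc k) \<omega> i) (x (Suc k) \<omega> i) (\<epsilon> (Suc k) i)"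
    and \<zeta>_step: "k \<le> K \<Longrightarrow> \<omega> \<in> space M \<Longrightarrow> i \<in> A k \<omega> \<Longrightarrow>
      \<zeta> (Suc k) \<omega> i = \<zeta> k \<omega> i + (x (Suc k) \<omega> i - b k \<omega>)"
    and idle: "k \<le> K \<Longrightarrow> \<omega> \<in> space M \<Longrightarrow> i \<in> I - A k \<omega> \<Longrightarrow>
      x (Suc k) \<omega> i = x k \<omega> i \<and> \<zeta> (Suc k) \<omega> i = \<zeta> k \<omega> i"
    and server: "k \<le> Suc K \<Longrightarrow> \<omega> \<in> space M \<Longrightarrow>
      real (card I) *\<^sub>R b k \<omega> = (\<Sum>i\<in>I. x k \<omega> i + \<zeta> k \<omega> i)"
    and F_min: "F_min \<le> (\<Sum>i\<in>I. \<phi> i y)"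
begin

section \<open>Bounds along a single trajectory\<close>

fun tol :: "nat \<Rightarrow> 'w \<Rightarrow> 'i \<Rightarrow> real" where
  "tol 0 \<omega> i = \<epsilon> 0 i"
| "tol (Suc k) \<omega> i = (if i \<in> A k \<omega> then \<epsilon> (Suc k) i else tol k \<omega> i)"

definition \<Psi> :: "nat \<Rightarrow> 'w \<Rightarrow> real" where
  "\<Psi> k \<omega> = potential (x k \<omega>) (\<zeta> k \<omega>) (b k \<omega>) (tol k \<omega>)"

definition R :: "nat \<Rightarrow> 'w \<Rightarrow> 'i \<Rightarrow> real" where
  "R k \<omega> i = gain (x k \<omega> i) (b k \<omega>) (tol k \<omega> i)"

definition noise :: "nat \<Rightarrow> 'i \<Rightarrow> real" where
  "noise k i = (2 * err + \<kappa> / \<theta>) * (\<epsilon> (Suc k) i)\<^sup>2"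

lemma noise_nonneg: "0 \<le> noise k i"
  unfolding noise_def using err_ge \<kappa>_pos \<theta>_pos by (intro mult_nonneg_nonneg add_nonneg_nonneg) auto

text \<open>Nearness involves only the client's own \<open>x\<close> and \<open>\<zeta>\<close>,
  both frozen while it is idle, so the tolerance of the latest activation remains valid although the
  server point has moved.\<close>

lemma near:
  assumes "\<omega> \<in> space M" "i \<in> I" "k \<le> Suc K"
  shows "near_resolvent (G i) (\<zeta> k \<omega> i) (x k \<omega> i) (tol k \<omega> i)"
  using assms(3)
proof (induction k)
  case 0
  then show ?case using init init_near assms by simp
next
  case (Suc k)
  then show ?case
    using near_step[of k \<omega> i] idle[of k \<omega> i] assms by (cases "i \<in> A k \<omega>") auto
qed

lemma \<Psi>_step:
  assumes \<omega>: "\<omega> \<in> space M" and k: "k \<le> K"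
  shows "\<Psi> (Suc k) \<omega> \<le> \<Psi> k \<omega> + (\<Sum>i\<in>I. indicator {B. i \<in> B} (A k \<omega>) * (noise k i - R k \<omega> i))"
proof -
  have "indicator {B. i \<in> B} (A k \<omega>) = (indicator (A k \<omega>) i :: real)" for i
    by (simp add: indicator_def)
  then show ?thesis
    unfolding \<Psi>_def noise_def R_def
    using potential_step[OF A_sub[OF k \<omega>], of "\<zeta> k \<omega>" "x k \<omega>" "tol k \<omega>" "\<zeta> (Suc k) \<omega>" "x (Suc k) \<omega>"
        "\<epsilon> (Suc k)" "b k \<omega>" "tol (Suc k) \<omega>" "b (Suc k) \<omega>"]
      near[OF \<omega>, of _ k] near_step[OF k \<omega>] \<zeta>_step[OF k \<omega>] idle[OF k \<omega>] server[of "Suc k" \<omega>]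
      A_sub[OF k \<omega>] k \<omega>
    by (auto simp: subset_iff)
qed

lemma \<Psi>_init:
  assumes "\<omega> \<in> space M"
  shows "\<Psi> 0 \<omega> = (\<Sum>i\<in>I. \<phi> i x0) + (err + \<kappa> / \<theta>) * (\<Sum>i\<in>I. (\<epsilon> 0 i)\<^sup>2)"
  using init assms unfolding \<Psi>_def potential_def
  by (simp add: aug_lagr_def sum.distrib sum_distrib_left)

lemma \<Psi>_lower:
  assumes "\<omega> \<in> space M" "k \<le> Suc K"
  shows "F_min + (\<Sum>i\<in>I. 1 / 20 * (norm (b k \<omega> - x k \<omega> i))\<^sup>2 + \<kappa> / \<theta> * (tol k \<omega> i)\<^sup>2) \<le> \<Psi> k \<omega>"
  using potential_lower[of "\<zeta> k \<omega>" "x k \<omega>" "tol k \<omega>" "b k \<omega>"] near[OF assms(1)] assms(2)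
    F_min[of "b k \<omega>"]
  unfolding \<Psi>_def by fastforce

text \<open>Gives integrability of the gain. The factor \<open>20 * \<kappa>\<close> raises the
  coefficient \<open>1/20\<close> to \<open>\<kappa>\<close>, and the summand 1 covers the tolerance
  term.\<close>

lemma R_bound:
  assumes "\<omega> \<in> space M" "k \<le> Suc K"
  shows "(\<Sum>i\<in>I. R k \<omega> i) \<le> (20 * \<kappa> + 1) * (\<Psi> k \<omega> - F_min)"
proof -
  have "R k \<omega> i \<le> (20 * \<kappa> + 1) * (1 / 20 * (norm (b k \<omega> - x k \<omega> i))\<^sup>2 + \<kappa> / \<theta> * (tol k \<omega> i)\<^sup>2)" for i
  proof -
    define t V where "t = \<kappa> / \<theta> * (tol k \<omega> i)\<^sup>2" and "V = (norm (b k \<omega> - x k \<omega> i))\<^sup>2"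
    have "0 \<le> \<kappa> * t" "0 \<le> V"
      using \<kappa>_pos \<theta>_pos by (simp_all add: t_def V_def)
    moreover have "(20 * \<kappa> + 1) * (1 / 20 * V + t) = \<kappa> * V + t + (V / 20 + 20 * (\<kappa> * t))"
      by (simp add: field_simps)
    ultimately show ?thesis
      unfolding R_def gain_def t_def[symmetric] V_def[symmetric] by linarith
  qed
  then have "(\<Sum>i\<in>I. R k \<omega> i)
      \<le> (20 * \<kappa> + 1) * (\<Sum>i\<in>I. 1 / 20 * (norm (b k \<omega> - x k \<omega> i))\<^sup>2 + \<kappa> / \<theta> * (tol k \<omega> i)\<^sup>2)"
    unfolding sum_distrib_left by (intro sum_mono)
  also have "\<dots> \<le> (20 * \<kappa> + 1) * (\<Psi> k \<omega> - F_min)"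
    using \<Psi>_lower[OF assms] \<kappa>_pos by (intro mult_left_mono) auto
  finally show ?thesis .
qed

lemma R_nonneg: "0 \<le> R k \<omega> i"
  by (simp add: R_def gain_nonneg)

text \<open>The gain is nonnegative, so each iteration raises the potential by at most the
  deterministic total noise. The bound is uniform in the outcome.\<close>

lemma \<Psi>_bounded: "\<exists>C. \<forall>\<omega>\<in>space M. \<forall>k\<le>Suc K. F_min \<le> \<Psi> k \<omega> \<and> \<Psi> k \<omega> \<le> C"
proof -
  define C where "C k = (\<Sum>i\<in>I. \<phi> i x0) + (err + \<kappa> / \<theta>) * (\<Sum>i\<in>I. (\<epsilon> 0 i)\<^sup>2)
    + (\<Sum>j<k. \<Sum>i\<in>I. noise j i)" for k
  have upper: "\<Psi> k \<omega> \<le> C k" if \<omega>: "\<omega> \<in> space M" and k: "k \<le> Suc K" for k \<omega>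
    using k
  proof (induction k)
    case 0
    then show ?case using \<Psi>_init[OF \<omega>] by (simp add: C_def)
  next
    case (Suc k)
    have "(\<Sum>i\<in>I. indicator {B. i \<in> B} (A k \<omega>) * (noise k i - R k \<omega> i)) \<le> (\<Sum>i\<in>I. noise k i)"
      using R_nonneg noise_nonneg by (intro sum_mono) (auto simp: indicator_def)
    then show ?case
      using Suc \<Psi>_step[OF \<omega>, of k] by (simp add: C_def)
  qed
  have "C k \<le> C (Suc K)" if "k \<le> Suc K" for k
    unfolding C_def using that noise_nonneg
    by (intro add_left_mono sum_mono2 sum_nonneg) auto
  moreover have "F_min \<le> \<Psi> k \<omega>" if "\<omega> \<in> space M" "k \<le> Suc K" for k \<omega>
  proof -
    have "0 \<le> (\<Sum>i\<in>I. 1 / 20 * (norm (b k \<omega> - x k \<omega> i))\<^sup>2 + \<kappa> / \<theta> * (tol k \<omega> i)\<^sup>2)"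
      using \<kappa>_pos \<theta>_pos by (intro sum_nonneg) auto
    then show ?thesis using \<Psi>_lower[OF that] by linarith
  qed
  ultimately show ?thesis
    using upper order_trans by blast
qed

section \<open>Measurability and integrability\<close>

lemma tol_meas: "k \<le> Suc K \<Longrightarrow> i \<in> I \<Longrightarrow> (\<lambda>\<omega>. tol k \<omega> i) \<in> borel_measurable (H k)"
proof (induction k)
  case (Suc k)
  have "subalgebra (H (Suc k)) (H k)"
    using filtration unfolding filtration_def subalgebra_def by auto
  then have [measurable]: "(\<lambda>\<omega>. tol k \<omega> i) \<in> borel_measurable (H (Suc k))"
    using Suc by (auto intro: measurable_from_subalg)
  have [measurable]: "Measurable.pred (H (Suc k)) (\<lambda>\<omega>. i \<in> A k \<omega>)"
    using Suc by (intro measurable_compose[OF A_meas]) auto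
  show ?case by simp
qed simp

lemma \<phi>_G_meas: "i \<in> I \<Longrightarrow> \<phi> i \<in> borel_measurable borel" "i \<in> I \<Longrightarrow> G i \<in> borel_measurable borel"
  using smooth_fun.continuous[OF smooth] smooth_fun.continuous_grad[OF smooth]
  by (auto intro: borel_measurable_continuous_onI)

lemma R_meas: "k \<le> Suc K \<Longrightarrow> i \<in> I \<Longrightarrow> (\<lambda>\<omega>. R k \<omega> i) \<in> borel_measurable (H k)"
  using x_meas[of k i] b_meas[of k] tol_meas[of k i] unfolding R_def gain_def by measurable

lemma \<Psi>_meas: "k \<le> Suc K \<Longrightarrow> \<Psi> k \<in> borel_measurable (H k)"
proof -
  assume k: "k \<le> Suc K"
  have "(\<lambda>\<omega>. aug_lagr (\<phi> i) (x k \<omega> i) (\<zeta> k \<omega> i) (b k \<omega>) + (err + \<kappa> / \<theta>) * (tol k \<omega> i)\<^sup>2)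
      \<in> borel_measurable (H k)" if i: "i \<in> I" for i
    using measurable_compose[OF x_meas[OF k i] \<phi>_G_meas(1)[OF i]]
      x_meas[OF k i] \<zeta>_meas[OF k i] b_meas[OF k] tol_meas[OF k i]
    unfolding aug_lagr_def by measurable
  then show ?thesis
    unfolding \<Psi>_def potential_def by (intro borel_measurable_sum)
qed

lemma integrable_\<Psi>: "k \<le> Suc K \<Longrightarrow> integrable M (\<Psi> k)"
proof -
  assume k: "k \<le> Suc K"
  obtain C where C: "\<And>\<omega> k. \<omega> \<in> space M \<Longrightarrow> k \<le> Suc K \<Longrightarrow> F_min \<le> \<Psi> k \<omega> \<and> \<Psi> k \<omega> \<le> C"
    using \<Psi>_bounded by blast
  show ?thesis
  proof (rule integrable_const_bound[where B="\<bar>F_min\<bar> + \<bar>C\<bar>"])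
    show "AE \<omega> in M. norm (\<Psi> k \<omega>) \<le> \<bar>F_min\<bar> + \<bar>C\<bar>"
      using C k by (intro AE_I2) (fastforce simp: abs_le_iff)
    show "\<Psi> k \<in> borel_measurable M"
      by (rule measurable_from_subalg[OF subalg \<Psi>_meas[OF k]])
  qed
qed

lemma integrable_R:
  assumes k: "k \<le> Suc K" and i: "i \<in> I"
  shows "integrable M (\<lambda>\<omega>. R k \<omega> i)"
proof (rule Bochner_Integration.integrable_bound)
  show "integrable M (\<lambda>\<omega>. (20 * \<kappa> + 1) * (\<Psi> k \<omega> - F_min))"
    using integrable_\<Psi>[OF k] by simp
  show "(\<lambda>\<omega>. R k \<omega> i) \<in> borel_measurable M"
    by (rule measurable_from_subalg[OF subalg R_meas[OF k i]])
  have "norm (R k \<omega> i) \<le> norm ((20 * \<kappa> + 1) * (\<Psi> k \<omega> - F_min))" if "\<omega> \<in> space M" for \<omega>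
  proof -
    have "R k \<omega> i \<le> (\<Sum>i\<in>I. R k \<omega> i)"
      using R_nonneg by (intro member_le_sum finite_I i)
    then show ?thesis
      using R_bound[OF that k] R_nonneg[of k \<omega> i] by simp
  qed
  then show "AE \<omega> in M. norm (R k \<omega> i) \<le> norm ((20 * \<kappa> + 1) * (\<Psi> k \<omega> - F_min))"
    by (intro AE_I2)
qed

section \<open>Decrease in expectation and the resulting rate\<close>

lemma expectation_\<Psi>_step:
  assumes k: "k \<le> K" and q: "0 \<le> q" "\<And>i. i \<in> I \<Longrightarrow> q \<le> prob {\<omega>\<in>space M. i \<in> A k \<omega>}"
  shows "expectation (\<Psi> (Suc k)) \<le> expectation (\<Psi> k) + (\<Sum>i\<in>I. noise k i)
    - q * (\<Sum>i\<in>I. expectation (\<lambda>\<omega>. R k \<omega> i))"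
proof -
  define Y where "Y i \<omega> = noise k i - R k \<omega> i" for i \<omega>
  have Y: "Y i \<in> borel_measurable (H k)" "integrable M (Y i)" if "i \<in> I" for i
    using R_meas[of k i] integrable_R[of k i] k that by (auto simp: Y_def[abs_def])
  note ind = expectation_indicator_indep[OF A_indep[OF k] subalg Y]
  have "expectation (\<Psi> (Suc k))
      \<le> expectation (\<lambda>\<omega>. \<Psi> k \<omega> + (\<Sum>i\<in>I. indicator {B. i \<in> B} (A k \<omega>) * Y i \<omega>))"
    using k \<Psi>_step[OF _ k] ind(2)
    by (intro integral_mono integrable_\<Psi> Bochner_Integration.integrable_add
        Bochner_Integration.integrable_sum) (auto simp: Y_def)
  also have "\<dots> = expectation (\<Psi> k) + (\<Sum>i\<in>I. prob {\<omega>\<in>space M. i \<in> A k \<omega>} * expectation (Y i))"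
    using k ind by (subst Bochner_Integration.integral_add)
      (auto intro!: integrable_\<Psi> Bochner_Integration.integrable_sum simp: Bochner_Integration.integral_sum)
  also have "\<dots> \<le> expectation (\<Psi> k) + (\<Sum>i\<in>I. noise k i - q * expectation (\<lambda>\<omega>. R k \<omega> i))"
  \<comment> \<open>The inclusion probability is bounded in opposite directions: by \<open>q\<close>
    from below at the nonnegative gain, and by 1 from above at the nonnegative noise.\<close>
  proof (intro add_left_mono sum_mono)
    fix i assume i: "i \<in> I"
    have "expectation (Y i) = noise k i - expectation (\<lambda>\<omega>. R k \<omega> i)"
      using integrable_R[OF _ i, of k] k by (simp add: Y_def[abs_def] prob_space)
    moreover have "q * expectation (\<lambda>\<omega>. R k \<omega> i)
        \<le> prob {\<omega>\<in>space M. i \<in> A k \<omega>} * expectation (\<lambda>\<omega>. R k \<omega> i)"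
      using q(2)[OF i] R_nonneg by (intro mult_right_mono Bochner_Integration.integral_nonneg) auto
    moreover have "prob {\<omega>\<in>space M. i \<in> A k \<omega>} * noise k i \<le> 1 * noise k i"
      by (intro mult_right_mono prob_le_1 noise_nonneg)
    ultimately show "prob {\<omega>\<in>space M. i \<in> A k \<omega>} * expectation (Y i)
        \<le> noise k i - q * expectation (\<lambda>\<omega>. R k \<omega> i)"
      by (simp add: right_diff_distrib)
  qed
  finally show ?thesis
    by (simp add: sum_subtractf sum_distrib_left)
qed

lemma gradient_sum_pointwise:
  assumes "\<omega> \<in> space M" "k \<le> Suc K"
  shows "\<kappa> / (1 + \<theta>) * (norm (\<Sum>i\<in>I. G i (b k \<omega>)))\<^sup>2 \<le> real (card I) * (1 + l)\<^sup>2 * (\<Sum>i\<in>I. R k \<omega> i)"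
  unfolding R_def by (intro gradient_sum_bound[where \<zeta>="\<zeta> k \<omega>"] near server assms)

lemma integrable_gradient_sum:
  assumes k: "k \<le> Suc K"
  shows "integrable M (\<lambda>\<omega>. (norm (\<Sum>i\<in>I. G i (b k \<omega>)))\<^sup>2)"
proof (rule Bochner_Integration.integrable_bound)
  show "integrable M (\<lambda>\<omega>. (1 + \<theta>) / \<kappa> * (real (card I) * (1 + l)\<^sup>2 * (\<Sum>i\<in>I. R k \<omega> i)))"
    using integrable_R[OF k] by (intro integrable_mult_right Bochner_Integration.integrable_sum)
  have "b k \<in> borel_measurable M"
    by (rule measurable_from_subalg[OF subalg b_meas[OF k]])
  then have "(\<lambda>\<omega>. G i (b k \<omega>)) \<in> borel_measurable M" if "i \<in> I" for i
    using \<phi>_G_meas(2)[OF that] by (rule measurable_compose)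
  then have "(\<lambda>\<omega>. \<Sum>i\<in>I. G i (b k \<omega>)) \<in> borel_measurable M"
    by (rule borel_measurable_sum)
  then show "(\<lambda>\<omega>. (norm (\<Sum>i\<in>I. G i (b k \<omega>)))\<^sup>2) \<in> borel_measurable M"
    by measurable
  show "AE \<omega> in M. norm ((norm (\<Sum>i\<in>I. G i (b k \<omega>)))\<^sup>2)
      \<le> norm ((1 + \<theta>) / \<kappa> * (real (card I) * (1 + l)\<^sup>2 * (\<Sum>i\<in>I. R k \<omega> i)))"
  proof (rule AE_I2)
    fix \<omega> assume \<omega>: "\<omega> \<in> space M"
    have "(norm (\<Sum>i\<in>I. G i (b k \<omega>)))\<^sup>2
        = (1 + \<theta>) / \<kappa> * (\<kappa> / (1 + \<theta>) * (norm (\<Sum>i\<in>I. G i (b k \<omega>)))\<^sup>2)"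
      using \<kappa>_pos \<theta>_pos by simp
    also have "\<dots> \<le> (1 + \<theta>) / \<kappa> * (real (card I) * (1 + l)\<^sup>2 * (\<Sum>i\<in>I. R k \<omega> i))"
      using gradient_sum_pointwise[OF \<omega> k] \<kappa>_pos \<theta>_pos by (intro mult_left_mono) auto
    finally show "norm ((norm (\<Sum>i\<in>I. G i (b k \<omega>)))\<^sup>2)
        \<le> norm ((1 + \<theta>) / \<kappa> * (real (card I) * (1 + l)\<^sup>2 * (\<Sum>i\<in>I. R k \<omega> i)))"
      unfolding real_norm_def abs_power2 by (rule order_trans[OF _ abs_ge_self])
  qed
qed

lemma gradient_sum_rate:
  assumes q: "0 \<le> q" "\<And>i k. i \<in> I \<Longrightarrow> k \<le> K \<Longrightarrow> q \<le> prob {\<omega>\<in>space M. i \<in> A k \<omega>}"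
  shows "q * (\<kappa> / (1 + \<theta>)) * (\<Sum>k\<le>K. expectation (\<lambda>\<omega>. (norm (\<Sum>i\<in>I. G i (b k \<omega>)))\<^sup>2))
    \<le> real (card I) * (1 + l)\<^sup>2 *
      ((\<Sum>i\<in>I. \<phi> i x0) - F_min + (err + \<kappa> / \<theta>) * (\<Sum>i\<in>I. (\<epsilon> 0 i)\<^sup>2)
        + (2 * err + \<kappa> / \<theta>) * (\<Sum>k\<le>K. \<Sum>i\<in>I. (\<epsilon> (Suc k) i)\<^sup>2))"
proof -
  define S where "S k = (\<Sum>i\<in>I. expectation (\<lambda>\<omega>. R k \<omega> i))" for k
  have step: "\<kappa> / (1 + \<theta>) * expectation (\<lambda>\<omega>. (norm (\<Sum>i\<in>I. G i (b k \<omega>)))\<^sup>2)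
      \<le> real (card I) * (1 + l)\<^sup>2 * S k" if k: "k \<le> K" for k
  proof -
    have k': "k \<le> Suc K" using k by simp
    have "expectation (\<lambda>\<omega>. \<kappa> / (1 + \<theta>) * (norm (\<Sum>i\<in>I. G i (b k \<omega>)))\<^sup>2)
        \<le> expectation (\<lambda>\<omega>. real (card I) * (1 + l)\<^sup>2 * (\<Sum>i\<in>I. R k \<omega> i))"
      using gradient_sum_pointwise[OF _ k'] integrable_gradient_sum[OF k'] integrable_R[OF k']
      by (intro integral_mono integrable_mult_right Bochner_Integration.integrable_sum)
    also have "\<dots> = real (card I) * (1 + l)\<^sup>2 * S k"
      using integrable_R[OF k'] by (simp add: S_def Bochner_Integration.integral_sum)
    finally show ?thesis by simp
  qed
  \<comment> \<open>Telescoping. The initial tolerances enter once, through \<open>\<Psi> 0\<close>,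
    and the sum ends one index past the last iteration.\<close>
  have "expectation (\<Psi> (Suc k)) + q * (\<Sum>j\<le>k. S j)
      \<le> (\<Sum>i\<in>I. \<phi> i x0) + (err + \<kappa> / \<theta>) * (\<Sum>i\<in>I. (\<epsilon> 0 i)\<^sup>2) + (\<Sum>j\<le>k. \<Sum>i\<in>I. noise j i)"
    if "k \<le> K" for k
    using that
  proof (induction k)
    case 0
    have "expectation (\<Psi> 0) = expectation (\<lambda>_. (\<Sum>i\<in>I. \<phi> i x0) + (err + \<kappa> / \<theta>) * (\<Sum>i\<in>I. (\<epsilon> 0 i)\<^sup>2))"
      by (intro Bochner_Integration.integral_cong \<Psi>_init) auto
    then show ?case
      using expectation_\<Psi>_step[of 0 q] q by (simp add: S_def prob_space)
  next
    case (Suc k)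
    then show ?case
      using expectation_\<Psi>_step[of "Suc k" q] q by (simp add: S_def distrib_left)
  qed
  from this[of K] have "q * (\<Sum>k\<le>K. S k) \<le> (\<Sum>i\<in>I. \<phi> i x0) - expectation (\<Psi> (Suc K))
      + (err + \<kappa> / \<theta>) * (\<Sum>i\<in>I. (\<epsilon> 0 i)\<^sup>2) + (\<Sum>k\<le>K. \<Sum>i\<in>I. noise k i)"
    by simp
  moreover have "F_min \<le> expectation (\<Psi> (Suc K))"
  proof -
    have "expectation (\<lambda>_. F_min) \<le> expectation (\<Psi> (Suc K))"
      using \<Psi>_bounded by (intro integral_mono integrable_\<Psi>) auto
    then show ?thesis by (simp add: prob_space)
  qed
  moreover have "(\<Sum>k\<le>K. \<Sum>i\<in>I. noise k i)
      = (2 * err + \<kappa> / \<theta>) * (\<Sum>k\<le>K. \<Sum>i\<in>I. (\<epsilon> (Suc k) i)\<^sup>2)"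
    by (simp only: noise_def sum_distrib_left)
  ultimately have bound: "q * (\<Sum>k\<le>K. S k) \<le> (\<Sum>i\<in>I. \<phi> i x0) - F_min
      + (err + \<kappa> / \<theta>) * (\<Sum>i\<in>I. (\<epsilon> 0 i)\<^sup>2)
      + (2 * err + \<kappa> / \<theta>) * (\<Sum>k\<le>K. \<Sum>i\<in>I. (\<epsilon> (Suc k) i)\<^sup>2)"
    by linarith
  have "q * (\<kappa> / (1 + \<theta>)) * (\<Sum>k\<le>K. expectation (\<lambda>\<omega>. (norm (\<Sum>i\<in>I. G i (b k \<omega>)))\<^sup>2))
      = q * (\<Sum>k\<le>K. \<kappa> / (1 + \<theta>) * expectation (\<lambda>\<omega>. (norm (\<Sum>i\<in>I. G i (b k \<omega>)))\<^sup>2))"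
    by (simp only: sum_distrib_left mult.assoc)
  also have "\<dots> \<le> q * (\<Sum>k\<le>K. real (card I) * (1 + l)\<^sup>2 * S k)"
    using step q by (intro mult_left_mono sum_mono) auto
  also have "\<dots> = real (card I) * (1 + l)\<^sup>2 * (q * (\<Sum>k\<le>K. S k))"
    unfolding sum_distrib_left[symmetric] by (simp only: mult_ac)
  also have "\<dots> \<le> real (card I) * (1 + l)\<^sup>2 * ((\<Sum>i\<in>I. \<phi> i x0) - F_min
      + (err + \<kappa> / \<theta>) * (\<Sum>i\<in>I. (\<epsilon> 0 i)\<^sup>2)
      + (2 * err + \<kappa> / \<theta>) * (\<Sum>k\<le>K. \<Sum>i\<in>I. (\<epsilon> (Suc k) i)\<^sup>2))"
    using bound by (intro mult_left_mono) auto
  finally show ?thesis .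
qed

end

section \<open>FedADMM without regularizer\<close>

text \<open>The margin is the quadratic
  \<open>(1 - 4 * \<gamma>) - l - 2 * (1 + 2 * \<gamma>) * l\<^sup>2\<close>. Its discriminant is
  the radicand, and the condition on \<open>\<eta>\<close> says that \<open>l\<close> lies below its
  positive root.\<close>

lemma margin_pos:
  fixes L \<eta> \<gamma> :: real
  assumes "0 \<le> L" "0 < \<eta>" "0 < \<gamma>" and s: "sqrt (9 - 16 * \<gamma> * (1 + 4 * \<gamma>)) - 1 > 0"
    and \<eta>: "\<eta> > 4 * L * (1 + 2 * \<gamma>) / (sqrt (9 - 16 * \<gamma> * (1 + 4 * \<gamma>)) - 1)"
    and l: "l = L / \<eta>"
  shows "0 < 1 - l - 2 * l\<^sup>2 - 4 * \<gamma> * (1 + l\<^sup>2)"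
proof -
  define r where "r = sqrt (9 - 16 * \<gamma> * (1 + 4 * \<gamma>))"
  have "4 * L * (1 + 2 * \<gamma>) < \<eta> * (r - 1)"
    using \<eta> s unfolding r_def[symmetric] by (simp add: pos_divide_less_eq)
  then have "1 + 4 * l * (1 + 2 * \<gamma>) < r"
    using \<open>0 < \<eta>\<close> unfolding l by (simp add: field_simps)
  moreover have "0 \<le> 1 + 4 * l * (1 + 2 * \<gamma>)"
    using assms(1-3) unfolding l by simp
  ultimately have "(1 + 4 * l * (1 + 2 * \<gamma>))\<^sup>2 < r\<^sup>2"
    by (intro power_strict_mono) auto
  \<comment> \<open>The real \<open>sqrt\<close> is negative at negative arguments, so
    \<open>s\<close> forces the radicand to be positive.\<close>
  also have "r\<^sup>2 = 9 - 16 * \<gamma> * (1 + 4 * \<gamma>)"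
    unfolding r_def using s by (intro real_sqrt_pow2) (smt (verit) real_sqrt_le_0_iff)
  finally have "0 < 8 * (1 + 2 * \<gamma>) * (1 - l - 2 * l\<^sup>2 - 4 * \<gamma> * (1 + l\<^sup>2))"
    by (simp add: power2_eq_square algebra_simps)
  with \<open>0 < \<gamma>\<close> show ?thesis
    by (simp add: zero_less_mult_iff)
qed

lemma prox_zero:
  assumes "\<And>y. g y = 0" "0 < \<eta>"
  shows "prox g \<eta> x = x"
  unfolding prox_def arg_min_def is_arg_min_linorder
proof (rule some_equality)
  fix v assume "True \<and> (\<forall>y. True \<longrightarrow> g v + ereal (\<eta> / 2 * (norm (x - v))\<^sup>2)
    \<le> g y + ereal (\<eta> / 2 * (norm (x - y))\<^sup>2))"
  then have "\<eta> / 2 * (norm (x - v))\<^sup>2 \<le> \<eta> / 2 * (norm (x - x))\<^sup>2"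
    using assms by (metis add.left_neutral ereal_less_eq(3))
  then show "v = x"
    using assms(2) by (simp add: mult_le_0_iff)
qed (use assms in simp)

text \<open>Stationarity of the exact minimizer, divided by \<open>\<eta>\<close>. With the updated
  dual variable the inexact \<open>x\<close> cancels in \<open>x - \<zeta>\<close>, so the proximal
  equation of the exact minimizer holds whatever approximation was returned.\<close>

lemma near_resolvent_of_approx_minimizer:
  fixes fi :: "'a::euclidean_space \<Rightarrow> real"
  assumes diff: "\<And>y. fi differentiable (at y)" and g: "\<And>y. g y = 0" and \<eta>: "0 < \<eta>"
    and approx: "approx_minimizer (client_objective fi g \<eta> xb z) \<delta> x"
  shows "near_resolvent (\<lambda>y. (1 / \<eta>) *\<^sub>R gradient fi y) ((1 / \<eta>) *\<^sub>R z + (x - xb)) x \<delta>"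
proof -
  obtain u where u: "is_arg_min (client_objective fi g \<eta> xb z) (\<lambda>_. True) u" "dist x u \<le> \<delta>"
    using approx by (auto simp: approx_minimizer_def)
  define \<psi> where "\<psi> y = fi y + z \<bullet> (y - xb) + \<eta> / 2 * ((y - xb) \<bullet> (y - xb))" for y
  have "client_objective fi g \<eta> xb z y = ereal (\<psi> y)" for y
    by (simp add: client_objective_def \<psi>_def g power2_norm_eq_inner)
  then have min: "\<psi> u \<le> \<psi> y" for y
    using u(1) by (simp add: is_arg_min_linorder)
  have "(fi has_derivative (\<lambda>v. v \<bullet> gradient fi u)) (at u)"
    using GDERIV_gradient[OF diff] by (simp add: gderiv_def)
  then have "(\<psi> has_derivative (\<lambda>v. v \<bullet> (gradient fi u + z + \<eta> *\<^sub>R (u - xb)))) (at u)"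
    unfolding \<psi>_def
    by (auto intro!: derivative_eq_intros simp: inner_commute algebra_simps fun_eq_iff)
  then have "(\<lambda>v. v \<bullet> (gradient fi u + z + \<eta> *\<^sub>R (u - xb))) = (\<lambda>v. 0)"
    by (rule differential_zero_maxmin[OF UNIV_I open_UNIV]) (use min in auto)
  then have "gradient fi u + z + \<eta> *\<^sub>R (u - xb) = 0"
    by (metis inner_eq_zero_iff)
  then have "(1 / \<eta>) *\<^sub>R (gradient fi u + z + \<eta> *\<^sub>R (u - xb)) = 0"
    by simp
  then have "(1 / \<eta>) *\<^sub>R gradient fi u = x - u - ((1 / \<eta>) *\<^sub>R z + (x - xb))"
    using \<eta> by (simp add: algebra_simps add_eq_0_iff2)
  with u(2) show ?thesis
    by (auto simp: near_resolvent_def dist_norm)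
qed

text \<open>Idle clients contribute zero increments, so the incremental server update maintains the
  full average; the induction carries the hat and tilde variables along.\<close>

lemma fedadmm_run_server_average:
  assumes run: "fedadmm_run n m K f g \<eta> x0 \<epsilon> A x z xh xt xb"
    and g: "\<And>y. g y = 0" and \<eta>: "0 < \<eta>" and n: "n \<ge> 1" and k: "k \<le> Suc K"
  shows "real n *\<^sub>R xb k = (\<Sum>i=1..n. x i k + (1 / \<eta>) *\<^sub>R z i k)"
proof -
  have "xb k = xt k \<and> (\<forall>i\<in>{1..n}. xh i k = x i k + (1 / \<eta>) *\<^sub>R z i k)
      \<and> real n *\<^sub>R xt k = (\<Sum>i=1..n. xh i k)"
    using k
  proof (induction k)
    case 0
    then show ?case
      using run by (simp add: fedadmm_run_def sum_constant_scaleR)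
  next
    case (Suc k)
    then have k: "k \<le> K" by simp
    note IH = Suc.IH[OF le_SucI[OF k]]
    have A: "A k \<subseteq> {1..n}" and xt: "xt (Suc k) = xt k + (1 / real n) *\<^sub>R (\<Sum>i\<in>A k. xh i (Suc k) - xh i k)"
      and idle: "\<forall>i\<in>{1..n} - A k. x i (Suc k) = x i k \<and> z i (Suc k) = z i k \<and> xh i (Suc k) = xh i k"
      and act: "\<forall>i\<in>A k. xh i (Suc k) = x i (Suc k) + (1 / \<eta>) *\<^sub>R z i (Suc k)"
      and xb: "xb (Suc k) = prox g \<eta> (xt (Suc k))"
      using run k unfolding fedadmm_run_def by blast+
    have "xh i (Suc k) = x i (Suc k) + (1 / \<eta>) *\<^sub>R z i (Suc k)" if "i \<in> {1..n}" for i
      using idle act IH that by (cases "i \<in> A k") auto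
    moreover have "real n *\<^sub>R xt (Suc k) = (\<Sum>i=1..n. xh i (Suc k))"
    proof -
      have "(\<Sum>i\<in>A k. xh i (Suc k) - xh i k) = (\<Sum>i=1..n. xh i (Suc k) - xh i k)"
        using A idle by (intro sum.mono_neutral_left) auto
      then show ?thesis
        using IH n by (simp add: xt scaleR_add_right sum_subtractf)
    qed
    ultimately show ?case
      using xb prox_zero[OF g \<eta>] by auto
  qed
  then show ?thesis by simp
qed

lemma gradient_avg_fun:
  fixes f :: "nat \<Rightarrow> 'a::euclidean_space \<Rightarrow> real"
  assumes "\<And>i. i \<in> {1..n} \<Longrightarrow> f i differentiable (at y)"
  shows "gradient (avg_fun n f) y = (1 / real n) *\<^sub>R (\<Sum>i=1..n. gradient (f i) y)"
proof -
  have "avg_fun n f = (\<lambda>y. 1 / real n * (\<Sum>i=1..n. f i y))"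
    by (auto simp: avg_fun_def)
  then show ?thesis
    by (simp only:) (intro gradient_eqI GDERIV_cmult GDERIV_sum GDERIV_gradient assms)
qed

theorem theorem2:
  fixes f :: "nat \<Rightarrow> real ^ 'd \<Rightarrow> real"
    and g :: "real ^ 'd \<Rightarrow> ereal"
    and M :: "'w measure" and H :: "nat \<Rightarrow> 'w measure"
    and P :: "nat set pmf" and A :: "nat \<Rightarrow> 'w \<Rightarrow> nat set"
    and n m K :: nat and L \<eta> \<gamma>1 \<gamma>2 \<gamma>3 \<gamma>4 :: real
    and x0 :: "real ^ 'd" and \<epsilon> :: "nat \<Rightarrow> nat \<Rightarrow> real"
    and x z xh :: "nat \<Rightarrow> nat \<Rightarrow> 'w \<Rightarrow> real ^ 'd"
    and xt xb :: "nat \<Rightarrow> 'w \<Rightarrow> real ^ 'd"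
    and h p \<beta> \<rho>1 \<rho>2 C1 C2 C3 :: real and Fstar :: ereal
  assumes n: "n \<ge> 1"
    and f_diff: "\<And>i y. i \<in> {1..n} \<Longrightarrow> f i differentiable (at y)"
    and f_smooth: "\<And>i y w. i \<in> {1..n} \<Longrightarrow>
          norm (gradient (f i) y - gradient (f i) w) \<le> L * norm (y - w)"
    and g_pcc: "proper_closed_convex g"
    and dom_F: "{y. composite n f g y < \<infinity>} \<noteq> {}"
    and Fstar: "Fstar = (INF y. composite n f g y)"
    and F_bounded: "Fstar > -\<infinity>"
    and P_proper: "\<And>i. i \<in> {1..n} \<Longrightarrow> inclusion_prob P i > 0"
    and p: "p = min_inclusion_prob n P"
    and \<gamma>_pos: "\<gamma>1 > 0" "\<gamma>2 > 0" "\<gamma>3 > 0" "\<gamma>4 > 0"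
    and \<epsilon>_nonneg: "\<And>i k. \<epsilon> i k \<ge> 0"
    and \<eta>_pos: "\<eta> > 0"
    and \<gamma>4_admissible: "sqrt (9 - 16 * \<gamma>4 * (1 + 4 * \<gamma>4)) - 1 > 0"
    and \<eta>_large: "\<eta> > 4 * L * (1 + 2 * \<gamma>4) / (sqrt (9 - 16 * \<gamma>4 * (1 + 4 * \<gamma>4)) - 1)"
    and alg: "fedadmm M H P n m K f g \<eta> x0 \<epsilon> A x z xh xt xb"
    and init_tolerance: "\<And>i. i \<in> {1..n} \<Longrightarrow>
          approx_minimizer (client_objective (f i) g \<eta> x0 0) (\<epsilon> i 0) x0"
    and h: "h = 1 / \<eta>"
    and \<beta>: "\<beta> = p * (2 - (L * h + 1) - 2 * L\<^sup>2 * h\<^sup>2 - 4 * \<gamma>4 * (1 + L\<^sup>2 * h\<^sup>2)) /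
                (2 * h * (1 + \<gamma>1) * (1 + L\<^sup>2 * h\<^sup>2))"
    and \<rho>2: "\<rho>2 = 2 * (1 + h * L)\<^sup>2 / (\<gamma>4 * h) + (1 + h\<^sup>2 * L\<^sup>2) / h +
                (2 - (L * h + 1) - 2 * L\<^sup>2 * h\<^sup>2 - 4 * \<gamma>4 * (1 + L\<^sup>2 * h\<^sup>2)) /
                (2 * h * (1 + L\<^sup>2 * h\<^sup>2) * \<gamma>1)"
    and \<rho>1: "\<rho>1 = \<rho>2 + (1 + h\<^sup>2 * L\<^sup>2) / h"
    and C1: "C1 = 2 * (1 + h * L)\<^sup>2 * (1 + \<gamma>2) / (h\<^sup>2 * \<beta>)"
    and C2: "C2 = \<rho>1 * C1"
    and C3: "C3 = \<rho>2 * C1 + (1 + h * L)\<^sup>2 * (1 + \<gamma>2) / (h\<^sup>2 * \<gamma>2)"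
    and g_zero: "\<And>y. g y = 0"
  shows "\<beta> > 0 \<and>
    (\<forall>k\<le>K. integrable M (\<lambda>\<omega>. (norm (gradient (avg_fun n f) (xb k \<omega>)))\<^sup>2)) \<and>
    1 / real (K + 1) * (\<Sum>k=0..K. \<integral>\<omega>. (norm (gradient (avg_fun n f) (xb k \<omega>)))\<^sup>2 \<partial>M)
      \<le> C1 * real_of_ereal (composite n f g x0 - Fstar) / real (K + 1) +
        1 / (real n * real (K + 1)) *
          (\<Sum>k=0..K. \<Sum>i=1..n. C2 * (\<epsilon> i k)\<^sup>2 + C3 * (\<epsilon> i (k + 1))\<^sup>2)"
proof -
  note \<gamma>s = \<gamma>_pos
  have run: "fedadmm_run n m K f g \<eta> x0 \<epsilon> (\<lambda>k. A k \<omega>) (\<lambda>i k. x i k \<omega>) (\<lambda>i k. z i k \<omega>)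
      (\<lambda>i k. xh i k \<omega>) (\<lambda>k. xt k \<omega>) (\<lambda>k. xb k \<omega>)" if "\<omega> \<in> space M" for \<omega>
    using alg that unfolding fedadmm_def by blast
  have A_law: "A k \<in> measurable (H (Suc k)) (count_space UNIV)"
      "distr M (count_space UNIV) (A k) = measure_pmf P"
      "prob_space.indep_set M (sets (H k)) (sets (vimage_algebra (space M) (A k) (count_space UNIV)))"
    if "k \<le> K" for k
    using alg that unfolding fedadmm_def by blast+
  have subalg: "subalgebra M (H k)" for k
    using alg unfolding fedadmm_def by blast
  interpret prob_space M
    using alg unfolding fedadmm_def by blast

  define l where "l = L * h"
  have h_pos: "0 < h" using \<eta>_pos h by simp
  \<comment> \<open>The sign of \<open>L\<close> follows from the Lipschitz inequality at two points
    of distance 1.\<close>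
  have L_nonneg: "0 \<le> L"
  proof -
    obtain e :: "real ^ 'd" where "norm e = 1"
      using vector_choose_size[of 1] by auto
    then show ?thesis
      using order_trans[OF norm_ge_zero f_smooth[of 1 e 0]] n by simp
  qed
  have l_nonneg: "0 \<le> l" using L_nonneg h_pos by (simp add: l_def)
  have margin: "0 < 1 - l - 2 * l\<^sup>2 - 4 * \<gamma>4 * (1 + l\<^sup>2)"
    by (rule margin_pos[OF L_nonneg \<eta>_pos \<gamma>s(4) \<gamma>4_admissible \<eta>_large]) (simp add: l_def h)
  define \<phi> where "\<phi> i y = h * f i y" for i y
  define G where "G i y = h *\<^sub>R gradient (f i) y" for i y
  have smooth: "smooth_fun (\<phi> i) (G i) l" if i: "i \<in> {1..n}" for i
  proof
    show "GDERIV (\<phi> i) y :> G i y" for y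
      unfolding \<phi>_def G_def by (intro GDERIV_cmult GDERIV_gradient f_diff i)
    have "h * norm (gradient (f i) y - gradient (f i) w) \<le> h * (L * norm (y - w))" for y w
      using f_smooth[OF i] h_pos by (intro mult_left_mono) auto
    then show "norm (G i y - G i w) \<le> l * norm (y - w)" for y w
      unfolding G_def scaleR_diff_right[symmetric] using h_pos by (simp add: l_def mult_ac)
  qed

  \<comment> \<open>The infimum is below the real value at \<open>x0\<close>, so together with the
    lower bound it is finite.\<close>
  obtain Fs where Fs: "Fstar = ereal Fs"
  proof (cases Fstar)
    case PInf
    have "Fstar \<le> composite n f g x0"
      unfolding Fstar by (rule INF_lower) simp
    with PInf show ?thesis by (simp add: composite_def g_zero)
  qed (use F_bounded that in auto)
  have Fs_le: "Fs \<le> avg_fun n f y" for y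
  proof -
    have "Fstar \<le> composite n f g y"
      unfolding Fstar by (rule INF_lower) simp
    then show ?thesis by (simp add: Fs composite_def g_zero)
  qed
  have sum_\<phi>: "(\<Sum>i=1..n. \<phi> i y) = real n * h * avg_fun n f y" for y
    using n by (simp add: \<phi>_def avg_fun_def sum_distrib_left)

  interpret random_clients "{1..n}" \<phi> G l \<gamma>4 \<gamma>1 M H K A
    "\<lambda>k \<omega> i. x i k \<omega>" "\<lambda>k \<omega> i. h *\<^sub>R z i k \<omega>" xb "\<lambda>k i. \<epsilon> i k" x0 "real n * h * Fs"
  proof (intro random_clients.intro clients.intro random_clients_axioms.intro prob_space_axioms)
    show "smooth_fun (\<phi> i) (G i) l" if "i \<in> {1..n}" for i
      by (rule smooth[OF that])
    show "filtration (space M) H"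
      using alg unfolding fedadmm_def by blast
    show "near_resolvent (G i) 0 x0 (\<epsilon> i 0)" if "i \<in> {1..n}" for i
      using near_resolvent_of_approx_minimizer[OF f_diff[OF that] g_zero \<eta>_pos init_tolerance[OF that]]
      by (simp add: G_def[abs_def] h)
    fix k assume k: "k \<le> K"
    fix \<omega> assume \<omega>: "\<omega> \<in> space M"
    note r = run[OF \<omega>, unfolded fedadmm_run_def]
    show "A k \<omega> \<subseteq> {1..n}"
      using r k by blast
    show "x i (Suc k) \<omega> = x i k \<omega> \<and> h *\<^sub>R z i (Suc k) \<omega> = h *\<^sub>R z i k \<omega>" if "i \<in> {1..n} - A k \<omega>" for i
      using r k that by simp
    fix i assume i: "i \<in> A k \<omega>"
    have zi: "z i (Suc k) \<omega> = z i k \<omega> + \<eta> *\<^sub>R (x i (Suc k) \<omega> - xb k \<omega>)"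
      and ap: "approx_minimizer (client_objective (f i) g \<eta> (xb k \<omega>) (z i k \<omega>)) (\<epsilon> i (Suc k)) (x i (Suc k) \<omega>)"
      and iI: "i \<in> {1..n}"
      using r k i by blast+
    show *: "h *\<^sub>R z i (Suc k) \<omega> = h *\<^sub>R z i k \<omega> + (x i (Suc k) \<omega> - xb k \<omega>)"
      using \<eta>_pos by (simp add: zi h scaleR_add_right)
    show "near_resolvent (G i) (h *\<^sub>R z i (Suc k) \<omega>) (x i (Suc k) \<omega>) (\<epsilon> i (Suc k))"
      using near_resolvent_of_approx_minimizer[OF f_diff[OF iI] g_zero \<eta>_pos ap]
      unfolding * by (simp add: G_def[abs_def] h)
  next
    fix k \<omega> assume k: "k \<le> Suc K" and \<omega>: "\<omega> \<in> space M"
    show "real (card {1..n}) *\<^sub>R xb k \<omega> = (\<Sum>i=1..n. x i k \<omega> + h *\<^sub>R z i k \<omega>)"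
      using fedadmm_run_server_average[OF run[OF \<omega>] g_zero \<eta>_pos n k] by (simp add: h)
  next
    fix y show "real n * h * Fs \<le> (\<Sum>i=1..n. \<phi> i y)"
      unfolding sum_\<phi> using h_pos Fs_le by (intro mult_left_mono) auto
  next
    fix k i assume "k \<le> Suc K" "i \<in> {1..n}"
    then have "x i k \<in> borel_measurable (H k)" "z i k \<in> borel_measurable (H k)"
      using alg unfolding fedadmm_def by blast+
    then show "x i k \<in> borel_measurable (H k)" "(\<lambda>\<omega>. h *\<^sub>R z i k \<omega>) \<in> borel_measurable (H k)"
      by measurable
  next
    fix k assume "k \<le> Suc K"
    then show "xb k \<in> borel_measurable (H k)"
      using alg unfolding fedadmm_def by blast
  next
    fix \<omega> assume \<omega>: "\<omega> \<in> space M"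
    show "xb 0 \<omega> = x0"
      using run[OF \<omega>] by (simp add: fedadmm_run_def)
    fix i assume i: "i \<in> {1..n}"
    show "x i 0 \<omega> = x0" "h *\<^sub>R z i 0 \<omega> = 0"
      using run[OF \<omega>] i by (simp_all add: fedadmm_run_def)
  qed (use l_nonneg \<gamma>s margin subalg A_law in auto)

  have p_le: "p \<le> prob {\<omega>\<in>space M. i \<in> A k \<omega>}" if i: "i \<in> {1..n}" and k: "k \<le> K" for i k
  proof -
    have "A k \<in> measurable M (count_space UNIV)"
      by (rule measurable_from_subalg[OF subalg A_law(1)[OF k]])
    then have "prob {\<omega>\<in>space M. i \<in> A k \<omega>} = measure (distr M (count_space UNIV) (A k)) {B. i \<in> B}"
      by (subst measure_distr) (auto simp: vimage_def Int_def intro!: arg_cong[where f=prob])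
    also have "\<dots> = inclusion_prob P i"
      by (simp add: A_law(2)[OF k] inclusion_prob_def)
    finally show ?thesis
      using i by (simp add: p min_inclusion_prob_def)
  qed
  have p_pos: "0 < p"
    using n P_proper by (auto simp: p min_inclusion_prob_def)

  \<comment> \<open>The coefficient on the left of the rate inequality. The constants of the theorem
    become \<open>\<beta> = 2 * w / h\<close> and
    \<open>C1 = (1 + \<gamma>2) * ((1 + l)\<^sup>2 / (h * w))\<close>.\<close>
  define w where "w = p * (\<kappa> / (1 + \<gamma>1))"
  have w_pos: "0 < w"
    using p_pos \<kappa>_pos \<gamma>s by (simp add: w_def)
  have l2: "1 + l\<^sup>2 \<noteq> 0"
    using zero_le_power2[of l] by linarith
  have margin_eq: "2 - (L * h + 1) - 2 * L\<^sup>2 * h\<^sup>2 - 4 * \<gamma>4 * (1 + L\<^sup>2 * h\<^sup>2) = 4 * (1 + l\<^sup>2) * \<kappa>"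
  proof -
    have "4 * (1 + l\<^sup>2) * \<kappa> = 1 - l - 2 * l\<^sup>2 - 4 * \<gamma>4 * (1 + l\<^sup>2)"
      using l2 by (simp add: \<kappa>_def)
    then show ?thesis by (simp add: l_def power_mult_distrib)
  qed
  have Lh: "L\<^sup>2 * h\<^sup>2 = l\<^sup>2" "h\<^sup>2 * L\<^sup>2 = l\<^sup>2" "h * L = l"
    by (simp_all add: l_def power_mult_distrib mult.commute)
  have \<beta>_eq: "\<beta> = 2 * w / h"
  proof -
    have "p * (4 * a * \<kappa>) / (2 * h * c * a) = 2 * (p * (\<kappa> / c)) / h" if "a \<noteq> 0" "c \<noteq> 0" for a c
      using that h_pos by (simp add: field_simps)
    from this[OF l2, of "1 + \<gamma>1"] show ?thesis
      unfolding \<beta> margin_eq unfolding Lh w_def using \<gamma>s by simp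
  qed
  then have \<beta>_pos: "\<beta> > 0"
    using w_pos h_pos by simp
  have \<rho>2_eq: "\<rho>2 = (2 * err + (1 + l\<^sup>2) + 2 * \<kappa> / \<gamma>1) / h"
  proof -
    have "4 * a * \<kappa> / (2 * h * a * \<gamma>1) = 2 * \<kappa> / \<gamma>1 / h" if "a \<noteq> 0" for a
      using that h_pos \<gamma>s by (simp add: field_simps)
    from this[OF l2] show ?thesis
      unfolding \<rho>2 margin_eq unfolding Lh err_def by (simp add: add_divide_distrib)
  qed
  have C1_eq: "C1 = (1 + \<gamma>2) * ((1 + l)\<^sup>2 / (h * w))"
    unfolding C1 \<beta>_eq Lh using w_pos h_pos by (simp add: field_simps power2_eq_square)

  have grad: "(\<Sum>i=1..n. G i y) = (real n * h) *\<^sub>R gradient (avg_fun n f) y" for y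
    using n f_diff by (subst gradient_avg_fun) (auto simp: G_def scaleR_sum_right[symmetric])
  have grad_sq: "(norm (\<Sum>i=1..n. G i y))\<^sup>2 = (real n * h)\<^sup>2 * (norm (gradient (avg_fun n f) y))\<^sup>2" for y
    by (simp only: grad norm_scaleR power_mult_distrib power2_abs)
  have nh: "(real n * h)\<^sup>2 \<noteq> 0" using n h_pos by simp

  have int: "integrable M (\<lambda>\<omega>. (norm (gradient (avg_fun n f) (xb k \<omega>)))\<^sup>2)" if "k \<le> K" for k
    using integrable_gradient_sum[of k, unfolded grad_sq] that n h_pos by simp

  define S where "S = (\<Sum>k=0..K. \<integral>\<omega>. (norm (gradient (avg_fun n f) (xb k \<omega>)))\<^sup>2 \<partial>M)"
  define \<Delta> where "\<Delta> = avg_fun n f x0 - Fs"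
  define E0 where "E0 = (\<Sum>i=1..n. (\<epsilon> i 0)\<^sup>2)"
  define E1 where "E1 = (\<Sum>k=0..K. \<Sum>i=1..n. (\<epsilon> i (k + 1))\<^sup>2)"
  define X where "X = \<Delta> + (\<rho>2 * E0 + \<rho>2 * E1) / real n"
  have E_nonneg: "0 \<le> E0" "0 \<le> E1"
    unfolding E0_def E1_def by (auto intro!: sum_nonneg)
  have \<rho>_pos: "0 \<le> \<rho>2" "\<rho>2 \<le> \<rho>1"
    using err_ge \<kappa>_pos \<gamma>s h_pos unfolding \<rho>2_eq \<rho>1 Lh by (auto intro!: add_nonneg_nonneg divide_nonneg_nonneg)
  have X_nonneg: "0 \<le> X"
    using Fs_le[of x0] \<rho>_pos E_nonneg unfolding X_def \<Delta>_def by simp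
  have C1_pos: "0 < C1"
    unfolding C1_eq using l_nonneg w_pos h_pos \<gamma>s by simp

  have "w * ((real n * h)\<^sup>2 * S)
      = p * (\<kappa> / (1 + \<gamma>1)) * (\<Sum>k\<le>K. expectation (\<lambda>\<omega>. (norm (\<Sum>i=1..n. G i (xb k \<omega>)))\<^sup>2))"
    unfolding grad_sq by (simp add: w_def S_def sum_distrib_left atLeast0AtMost)
  also have "\<dots> \<le> real n * (1 + l)\<^sup>2 * (real n * h * \<Delta> + (err + \<kappa> / \<gamma>1) * E0 + (2 * err + \<kappa> / \<gamma>1) * E1)"
    using gradient_sum_rate[OF less_imp_le[OF p_pos] p_le]
    unfolding sum_\<phi> E0_def E1_def \<Delta>_def right_diff_distrib
    by (simp only: atLeast0AtMost card_atLeastAtMost diff_Suc_1 Suc_eq_plus1 add_diff_cancel_right')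
  \<comment> \<open>A single constant serves for old and new tolerances: \<open>\<rho>2 * h\<close>
    dominates both coefficients.\<close>
  also have "\<dots> \<le> real n * (1 + l)\<^sup>2 * (real n * h * \<Delta> + \<rho>2 * h * E0 + \<rho>2 * h * E1)"
  proof -
    have "\<rho>2 * h = 2 * err + (1 + l\<^sup>2) + 2 * (\<kappa> / \<gamma>1)"
      unfolding \<rho>2_eq using h_pos by simp
    moreover have "0 \<le> \<kappa> / \<gamma>1" using \<kappa>_pos \<gamma>s by simp
    ultimately have "err + \<kappa> / \<gamma>1 \<le> \<rho>2 * h" "2 * err + \<kappa> / \<gamma>1 \<le> \<rho>2 * h"
      using err_ge zero_le_power2[of l] by linarith+
    then show ?thesis
      using E_nonneg by (intro mult_left_mono add_mono mult_right_mono order_refl) auto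
  qed
  also have "\<dots> = (real n)\<^sup>2 * h * (1 + l)\<^sup>2 * X"
    using n by (simp add: X_def power2_eq_square field_simps)
  finally have "((real n)\<^sup>2 * h) * (h * w * S) \<le> ((real n)\<^sup>2 * h) * ((1 + l)\<^sup>2 * X)"
    by (simp add: power_mult_distrib power2_eq_square[of h] mult_ac)
  then have "h * w * S \<le> (1 + l)\<^sup>2 * X"
    using n h_pos by (simp add: mult_le_cancel_left_pos)
  then have "S \<le> (1 + l)\<^sup>2 / (h * w) * X"
    using h_pos w_pos by (simp add: pos_le_divide_eq mult_ac)
  also have "\<dots> \<le> C1 * X"
  proof (rule mult_right_mono[OF _ X_nonneg])
    have "1 * ((1 + l)\<^sup>2 / (h * w)) \<le> (1 + \<gamma>2) * ((1 + l)\<^sup>2 / (h * w))"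
      using \<gamma>s w_pos h_pos by (intro mult_right_mono) auto
    then show "(1 + l)\<^sup>2 / (h * w) \<le> C1"
      by (simp only: C1_eq mult_1)
  qed
  finally have S_X: "S \<le> C1 * X" .
  have S_le: "S \<le> C1 * \<Delta> + (C2 * E0 + \<rho>2 * C1 * E1) / real n"
  proof -
    have "\<rho>2 * C1 * E0 \<le> C2 * E0"
      unfolding C2 using \<rho>_pos C1_pos E_nonneg by (intro mult_right_mono) auto
    then have "C1 * \<Delta> + (\<rho>2 * C1 * E0 + \<rho>2 * C1 * E1) / real n
        \<le> C1 * \<Delta> + (C2 * E0 + \<rho>2 * C1 * E1) / real n"
      by (intro add_left_mono divide_right_mono) auto
    moreover have "C1 * X = C1 * \<Delta> + (\<rho>2 * C1 * E0 + \<rho>2 * C1 * E1) / real n"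
      by (simp add: X_def algebra_simps add_divide_distrib)
    ultimately show ?thesis
      using S_X by linarith
  qed
  have "C2 * E0 + \<rho>2 * C1 * E1
      \<le> (\<Sum>k=0..K. \<Sum>i=1..n. C2 * (\<epsilon> i k)\<^sup>2 + C3 * (\<epsilon> i (k + 1))\<^sup>2)"
  proof -
    have "0 \<le> C2" unfolding C2 using \<rho>_pos C1_pos by simp
    have "\<rho>2 * C1 \<le> C3"
      unfolding C3 using \<gamma>s by simp
    \<comment> \<open>The potential argument charges old tolerances at index 0 only; this is one
      term of a nonnegative sum.\<close>
    have "C2 * E0 \<le> (\<Sum>k=0..K. \<Sum>i=1..n. C2 * (\<epsilon> i k)\<^sup>2)"
      unfolding E0_def sum_distrib_left
      by (rule member_le_sum[of 0 "{0..K}" "\<lambda>k. \<Sum>i=1..n. C2 * (\<epsilon> i k)\<^sup>2"])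
        (use \<open>0 \<le> C2\<close> in \<open>auto intro!: sum_nonneg\<close>)
    moreover have "\<rho>2 * C1 * E1 \<le> C3 * E1"
      using \<open>\<rho>2 * C1 \<le> C3\<close> E_nonneg by (intro mult_right_mono)
    moreover have "C3 * E1 = (\<Sum>k=0..K. \<Sum>i=1..n. C3 * (\<epsilon> i (k + 1))\<^sup>2)"
      by (simp only: E1_def sum_distrib_left)
    ultimately show ?thesis
      by (simp add: sum.distrib)
  qed
  then have "S \<le> C1 * \<Delta> + (\<Sum>k=0..K. \<Sum>i=1..n. C2 * (\<epsilon> i k)\<^sup>2 + C3 * (\<epsilon> i (k + 1))\<^sup>2) / real n"
    using S_le divide_right_mono[of "C2 * E0 + \<rho>2 * C1 * E1" _ "real n"] by fastforce
  then have "1 / real (K + 1) * S \<le> 1 / real (K + 1) * (C1 * \<Delta>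
      + (\<Sum>k=0..K. \<Sum>i=1..n. C2 * (\<epsilon> i k)\<^sup>2 + C3 * (\<epsilon> i (k + 1))\<^sup>2) / real n)"
    by (intro mult_left_mono) auto
  also have "\<dots> = C1 * \<Delta> / real (K + 1) + 1 / (real n * real (K + 1)) *
      (\<Sum>k=0..K. \<Sum>i=1..n. C2 * (\<epsilon> i k)\<^sup>2 + C3 * (\<epsilon> i (k + 1))\<^sup>2)"
    by (simp only: distrib_left times_divide_eq_left times_divide_eq_right mult_1 divide_divide_eq_left mult.commute)
  finally have "1 / real (K + 1) * S \<le> C1 * \<Delta> / real (K + 1) + 1 / (real n * real (K + 1)) *
      (\<Sum>k=0..K. \<Sum>i=1..n. C2 * (\<epsilon> i k)\<^sup>2 + C3 * (\<epsilon> i (k + 1))\<^sup>2)" .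
  moreover have "real_of_ereal (composite n f g x0 - Fstar) = \<Delta>"
    by (simp add: composite_def g_zero Fs \<Delta>_def)
  ultimately show ?thesis
    using \<beta>_pos int unfolding S_def by auto
qed

end
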